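(* Let $(Y_1,Y_0)$ have a joint density function, provisionally assumed to belong to the model $\mathcal{M}=\{f(y_1,y_0;\gamma,\psi):\gamma\in\Gamma,\ \psi\in\Psi\}$, where $\gamma$ is a nuisance parameter, $\psi$ is an interest parameter, and $f$ satisfies one of Structures 1–4 (defined in the context). When any such structure holds, define, respectively, \begin{align*} U^{(1)}(\psi_0) &:= F_{Y_1\mid S}(Y_1\mid s;\psi_0), & S&=s(Y_1,Y_0),\\ U^{(2)}(\psi_0) &:= F_{Y_1\mid S(\psi_0)}(Y_1\mid s(\psi_0)), & S(\psi_0)&=s(Y_1,Y_0;\psi_0),\\ U^{(3)}(\psi_0) &:= F_Z(Z;\psi_0), & Z&=t(Y_1,Y_0),\\ U^{(4)}(\psi_0) &:= F_{Z(\psi_0)}(Z(\psi_0)), & Z(\psi_0)&=t(Y_1,Y_0;\psi_0), \end{align*} where $S$ and $S(\psi_0)$ are sufficient for $\gamma$ at a particular value of $\psi_0$ under the relevant postulated model, and the distribution functions $F$ are those calculated under the postulated model at $\psi_0$. Then $U^{(k)}(\psi_0)\sim U(0,1)$ if and only if $\mathcal{M}$ holds with true parameter value $\psi^*=\psi_0$, or the true distribution of $(Y_0,Y_1)$, with density function $g^*$, belongs to the equivalence class $\mathcal{E}^{(k)}(\psi_0)$ specified in the context.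
   Context: **Setting.** $(Y_1,Y_0)$ are the outcomes on the treated and untreated units of a matched pair (the pair index is dropped). $U(0,1)$ is the standard uniform distribution. $\psi_0\in\Psi$ is a postulated value of the interest parameter and $\psi^*$ its true value when the model holds. Lower-case $s$ and $s(\psi_0)$ denote the observed values of the statistics $S$ and $S(\psi_0)$. **Structures.** - Structure 1: the joint density function $f(y_1,y_0;\gamma,\psi)$ of $(Y_1,Y_0)$ is such that there is a statistic $S:=s(Y_1,Y_0)$, not depending on $\psi$, that is sufficient for $\gamma$, and the conditional distribution function $F_{Y_1\mid S}(y\mid s;\psi)$ of $Y_1$ given $S=s$ is continuous and bijective in $y$ for any $\psi$, and injective in $\psi$ for any fixed $y$. - Structure 2: parallels Structure 1, except that the sufficient statistic depends on the interest parameter, $S(\psi)=s(Y_1,Y_0;\psi)$. - Structure 3: the joint density function $f(y_1,y_0;\gamma,\psi)$ of $(Y_1,Y_0)$ is such that there is a transformation $t$, not depending on $\psi$, such that $Z:=t(Y_1,Y_0)$ has a distribution function $F_Z(z;\psi)$ that is continuous and bijective in $z$ for any fixed $\psi$, injective in $\psi$ for any fixed $z$, and functionally independent of the nuisance parameter $\gamma$. - Structure 4: parallels Structure 3 (with the same continuity, bijectivity, injectivity and independence-of-$\gamma$ conditions), except that the transformation depends on the interest parameter, $Z(\psi)=t(Y_1,Y_0;\psi)$. **Equivalence classes.** Let $|J|$ be the absolute Jacobian determinant corresponding to the transformation from $(Y_0,Y_1)$ to $(S,Y_1)$ for $k=1$, to $(S(\psi_0),Y_1)$ for $k=2$, to $(Z,Y_1)$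 for $k=3$, and to $(Z(\psi_0),Y_1)$ for $k=4$. Write $y_0(s,y_1)$, $y_0(s(\psi_0),y_1)$, $y_0(z,y_1)$, $y_0(z(\psi_0),y_1)$ for $y_0$ expressed in terms of the transformed variables. Let $\mathcal{Y}_1$ be the range of $Y_1$, and $\mathcal{Y}_1(s)$, $\mathcal{Y}_1(s(\psi_0))$ its range given $S=s$, $S(\psi_0)=s(\psi_0)$. Lower-case $f_{Y_1\mid S}$, $f_{Y_1\mid S(\psi_0)}$, $f_Z$, $f_{Z(\psi_0)}$ are the density functions corresponding to $F_{Y_1\mid S}$, $F_{Y_1\mid S(\psi_0)}$, $F_Z$, $F_{Z(\psi_0)}$ under the postulated model at $\psi_0$. The classes consist of density functions $g$ over $(Y_0,Y_1)$ (arguments in that order): \begin{align*} \mathcal{E}^{(1)}(\psi_0)&=\Bigl\{g:\ \frac{g(y_0(s,y_1),y_1)\,|J|}{\int_{\mathcal{Y}_1(s)}g(y_0(s,y_1),y_1)\,|J|\,dy_1}=f_{Y_1\mid S}(y_1\mid s;\psi_0)\Bigr\},\\ \mathcal{E}^{(2)}(\psi_0)&=\Bigl\{g:\ \frac{g(y_0(s(\psi_0),y_1),y_1)\,|J|}{\int_{\mathcal{Y}_1(s(\psi_0))}g(y_0(s(\psi_0),y_1),y_1)\,|J|\,dy_1}=f_{Y_1\mid S(\psi_0)}(y_1\mid s(\psi_0))\Bigr\},\\ \mathcal{E}^{(3)}(\psi_0)&=\Bigl\{g:\ \int_{\mathcal{Y}_1}g(y_0(z,y_1),y_1)\,|J|\,dy_1=f_Z(z;\psi_0)\Bigr\},\\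 \mathcal{E}^{(4)}(\psi_0)&=\Bigl\{g:\ \int_{\mathcal{Y}_1}g(y_0(z(\psi_0),y_1),y_1)\,|J|\,dy_1=f_{Z(\psi_0)}(z(\psi_0))\Bigr\}. \end{align*} *)

theory Defs
  imports "HOL-Probability.Probability"
begin

text \<open>
  The sample space \<open>D\<close> consists of pairs \<open>(y0, y1)\<close>.  Curried functions keep the argument order
  of the mathematics: a true or candidate density is \<open>g y0 y1\<close>, a model density is \<open>f \<gamma> \<psi> y1 y0\<close>,
  and a statistic or transformation is \<open>s y1 y0\<close> (\<open>s \<psi> y1 y0\<close> when it depends on \<open>\<psi>\<close>).
\<close>

definition densities :: "(real \<times> real) set \<Rightarrow> (real \<Rightarrow> real \<Rightarrow> real) set" where
  "densities D =
    {g. (\<lambda>(y0, y1). g y0 y1) \<in> borel_measurable borel \<and>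
        (\<forall>y0 y1. 0 \<le> g y0 y1) \<and> (\<forall>y0 y1. (y0, y1) \<notin> D \<longrightarrow> g y0 y1 = 0) \<and>
        (\<integral>\<^sup>+ (y0, y1). ennreal (g y0 y1) \<partial>lborel) = 1}"

definition law :: "(real \<Rightarrow> real \<Rightarrow> real) \<Rightarrow> (real \<times> real) measure" where
  "law g = density lborel (\<lambda>(y0, y1). ennreal (g y0 y1))"

definition model_law ::
    "('c \<Rightarrow> 'p \<Rightarrow> real \<Rightarrow> real \<Rightarrow> real) \<Rightarrow> 'c \<Rightarrow> 'p \<Rightarrow> (real \<times> real) measure" where
  "model_law f \<gamma> \<psi> = law (\<lambda>y0 y1. f \<gamma> \<psi> y1 y0)"

definition is_model ::
    "(real \<times> real) set \<Rightarrow> 'c set \<Rightarrow> 'p set \<Rightarrow> ('c \<Rightarrow> 'p \<Rightarrow> real \<Rightarrow> real \<Rightarrow> real) \<Rightarrow> bool" where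
  "is_model D \<Gamma> \<Psi> f \<longleftrightarrow>
    D \<in> sets borel \<and> \<Gamma> \<noteq> {} \<and> (\<forall>\<gamma>\<in>\<Gamma>. \<forall>\<psi>\<in>\<Psi>. (\<lambda>y0 y1. f \<gamma> \<psi> y1 y0) \<in> densities D)"

text \<open>The model holds for the true density \<open>g\<close>, with true interest parameter \<open>\<psi>\<close>.\<close>

definition model_holds_at ::
    "'c set \<Rightarrow> 'p set \<Rightarrow> ('c \<Rightarrow> 'p \<Rightarrow> real \<Rightarrow> real \<Rightarrow> real) \<Rightarrow> (real \<Rightarrow> real \<Rightarrow> real) \<Rightarrow> 'p \<Rightarrow> bool" where
  "model_holds_at \<Gamma> \<Psi> f g \<psi> \<longleftrightarrow>
    \<psi> \<in> \<Psi> \<and> (\<exists>\<gamma>\<in>\<Gamma>. AE (y0, y1) in lborel. g y0 y1 = f \<gamma> \<psi> y1 y0)"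

definition stat :: "(real \<Rightarrow> real \<Rightarrow> real) \<Rightarrow> real \<times> real \<Rightarrow> real" where
  "stat s = (\<lambda>(y0, y1). s y1 y0)"

text \<open>The range of \<open>Y1\<close>, and its range given that the statistic takes the value \<open>\<sigma>\<close>.\<close>

definition range_Y1 :: "(real \<times> real) set \<Rightarrow> real set" where
  "range_Y1 D = snd ` D"

definition range_Y1_given :: "(real \<times> real) set \<Rightarrow> (real \<Rightarrow> real \<Rightarrow> real) \<Rightarrow> real \<Rightarrow> real set" where
  "range_Y1_given D s \<sigma> = {y1. \<exists>y0. (y0, y1) \<in> D \<and> s y1 y0 = \<sigma>}"

text \<open>\<open>K\<close> is a (regular) conditional distribution of \<open>Y\<close> given \<open>X\<close> under \<open>P\<close>.\<close>

definition cond_law ::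
    "'w measure \<Rightarrow> ('w \<Rightarrow> 'a::topological_space) \<Rightarrow> ('w \<Rightarrow> 'b::topological_space) \<Rightarrow>
     ('a \<Rightarrow> 'b measure) \<Rightarrow> bool" where
  "cond_law P X Y K \<longleftrightarrow>
    X \<in> borel_measurable P \<and> Y \<in> borel_measurable P \<and> K \<in> measurable borel (prob_algebra borel) \<and>
    (\<forall>A\<in>sets borel. \<forall>B\<in>sets borel.
       emeasure P {\<omega> \<in> space P. X \<omega> \<in> A \<and> Y \<omega> \<in> B} =
       (\<integral>\<^sup>+ x. emeasure (K x) B * indicator A x \<partial>distr P borel X))"

definition cond_df ::
    "'w measure \<Rightarrow> ('w \<Rightarrow> real) \<Rightarrow> ('w \<Rightarrow> real) \<Rightarrow> (real \<Rightarrow> real \<Rightarrow> real) \<Rightarrow> bool" where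
  "cond_df P X Y F \<longleftrightarrow> (\<exists>K. cond_law P X Y K \<and> (\<forall>x y. F x y = cdf (K x) y))"

text \<open>Sufficiency: the conditional distribution of the data given the statistic is common to all
  members of the family.\<close>

definition sufficient :: "'w::topological_space measure set \<Rightarrow> ('w \<Rightarrow> real) \<Rightarrow> bool" where
  "sufficient \<P> S \<longleftrightarrow> (\<exists>K. \<forall>P\<in>\<P>. cond_law P S (\<lambda>\<omega>. \<omega>) K)"

text \<open>Here \<open>F \<psi> \<sigma> y\<close> is the conditional distribution function at \<open>y\<close> of \<open>Y1\<close> given \<open>S(\<psi>) = \<sigma>\<close>.
  Off the range of \<open>Y1\<close> a distribution function is constantly 0 or 1, so bijectivity in \<open>y\<close> and
  injectivity in \<open>\<psi>\<close> refer to points of that range.\<close>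

definition structure2 ::
    "(real \<times> real) set \<Rightarrow> 'c set \<Rightarrow> 'p set \<Rightarrow> ('c \<Rightarrow> 'p \<Rightarrow> real \<Rightarrow> real \<Rightarrow> real) \<Rightarrow>
     ('p \<Rightarrow> real \<Rightarrow> real \<Rightarrow> real) \<Rightarrow> ('p \<Rightarrow> real \<Rightarrow> real \<Rightarrow> real) \<Rightarrow> bool" where
  "structure2 D \<Gamma> \<Psi> f s F \<longleftrightarrow>
    (\<forall>\<psi>\<in>\<Psi>. sufficient {model_law f \<gamma> \<psi> | \<gamma>. \<gamma> \<in> \<Gamma>} (stat (s \<psi>))) \<and>
    (\<forall>\<gamma>\<in>\<Gamma>. \<forall>\<psi>\<in>\<Psi>. cond_df (model_law f \<gamma> \<psi>) (stat (s \<psi>)) snd (F \<psi>)) \<and>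
    (\<forall>\<psi>\<in>\<Psi>. \<forall>\<sigma>\<in>stat (s \<psi>) ` D.
       continuous_on (range_Y1_given D (s \<psi>) \<sigma>) (F \<psi> \<sigma>) \<and>
       bij_betw (F \<psi> \<sigma>) (range_Y1_given D (s \<psi>) \<sigma>) {0<..<1}) \<and>
    (\<forall>\<sigma> y. inj_on (\<lambda>\<psi>. F \<psi> \<sigma> y) {\<psi> \<in> \<Psi>. y \<in> range_Y1_given D (s \<psi>) \<sigma>})"

definition structure1 ::
    "(real \<times> real) set \<Rightarrow> 'c set \<Rightarrow> 'p set \<Rightarrow> ('c \<Rightarrow> 'p \<Rightarrow> real \<Rightarrow> real \<Rightarrow> real) \<Rightarrow>
     (real \<Rightarrow> real \<Rightarrow> real) \<Rightarrow> ('p \<Rightarrow> real \<Rightarrow> real \<Rightarrow> real) \<Rightarrow> bool" where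
  "structure1 D \<Gamma> \<Psi> f s F \<longleftrightarrow> structure2 D \<Gamma> \<Psi> f (\<lambda>\<psi>. s) F"

text \<open>Here \<open>F \<psi>\<close> is the distribution function of \<open>Z(\<psi>)\<close>, the same for every \<open>\<gamma>\<close>.\<close>

definition structure4 ::
    "(real \<times> real) set \<Rightarrow> 'c set \<Rightarrow> 'p set \<Rightarrow> ('c \<Rightarrow> 'p \<Rightarrow> real \<Rightarrow> real \<Rightarrow> real) \<Rightarrow>
     ('p \<Rightarrow> real \<Rightarrow> real \<Rightarrow> real) \<Rightarrow> ('p \<Rightarrow> real \<Rightarrow> real) \<Rightarrow> bool" where
  "structure4 D \<Gamma> \<Psi> f t F \<longleftrightarrow>
    (\<forall>\<psi>\<in>\<Psi>. stat (t \<psi>) \<in> borel_measurable borel) \<and>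
    (\<forall>\<gamma>\<in>\<Gamma>. \<forall>\<psi>\<in>\<Psi>. \<forall>z. F \<psi> z = cdf (distr (model_law f \<gamma> \<psi>) borel (stat (t \<psi>))) z) \<and>
    (\<forall>\<psi>\<in>\<Psi>. continuous_on (stat (t \<psi>) ` D) (F \<psi>) \<and>
       bij_betw (F \<psi>) (stat (t \<psi>) ` D) {0<..<1}) \<and>
    (\<forall>z. inj_on (\<lambda>\<psi>. F \<psi> z) {\<psi> \<in> \<Psi>. z \<in> stat (t \<psi>) ` D})"

definition structure3 ::
    "(real \<times> real) set \<Rightarrow> 'c set \<Rightarrow> 'p set \<Rightarrow> ('c \<Rightarrow> 'p \<Rightarrow> real \<Rightarrow> real \<Rightarrow> real) \<Rightarrow>
     (real \<Rightarrow> real \<Rightarrow> real) \<Rightarrow> ('p \<Rightarrow> real \<Rightarrow> real) \<Rightarrow> bool" where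
  "structure3 D \<Gamma> \<Psi> f t F \<longleftrightarrow> structure4 D \<Gamma> \<Psi> f (\<lambda>\<psi>. t) F"

definition pdf_of :: "(real \<Rightarrow> real) \<Rightarrow> (real \<Rightarrow> real) \<Rightarrow> bool" where
  "pdf_of F h \<longleftrightarrow>
    h \<in> borel_measurable borel \<and> (\<forall>y. 0 \<le> h y) \<and>
    (\<forall>y. emeasure (density lborel (\<lambda>x. ennreal (h x))) {..y} = ennreal (F y))"

text \<open>The change of variables \<open>(y0, y1) \<mapsto> (s, y1)\<close> need only be regular on an open set \<open>D0\<close> that
  exhausts the sample space up to a Lebesgue null set (for instance, a ratio away from the axes).\<close>

definition change_vars :: "(real \<Rightarrow> real \<Rightarrow> real) \<Rightarrow> real \<times> real \<Rightarrow> real \<times> real" where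
  "change_vars s = (\<lambda>(y0, y1). (s y1 y0, y1))"

definition change_vars_inv ::
    "(real \<times> real) set \<Rightarrow> (real \<Rightarrow> real \<Rightarrow> real) \<Rightarrow> real \<times> real \<Rightarrow> real \<times> real" where
  "change_vars_inv D0 s = the_inv_into D0 (change_vars s)"

definition regular_change_vars ::
    "(real \<times> real) set \<Rightarrow> (real \<times> real) set \<Rightarrow> (real \<Rightarrow> real \<Rightarrow> real) \<Rightarrow> bool" where
  "regular_change_vars D D0 s \<longleftrightarrow>
    open D0 \<and> D0 \<subseteq> D \<and> D - D0 \<in> null_sets lborel \<and>
    inj_on (change_vars s) D0 \<and> change_vars s differentiable_on D0 \<and>
    change_vars_inv D0 s differentiable_on (change_vars s ` D0)"

definition jacobian_det :: "(real \<times> real \<Rightarrow> real \<times> real) \<Rightarrow> real \<times> real \<Rightarrow> real" where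
  "jacobian_det \<phi> p =
    (let A = frechet_derivative \<phi> (at p)
     in fst (A (1, 0)) * snd (A (0, 1)) - fst (A (0, 1)) * snd (A (1, 0)))"

text \<open>The integrand \<open>g(y0(s, y1), y1) |J|\<close>, zero where \<open>y0(s, y1)\<close> does not exist.  As a factor
  multiplying \<open>g(y0(s, y1), y1)\<close>, \<open>J\<close> is the Jacobian determinant of the old variables
  with respect to the new ones.\<close>

definition transformed ::
    "(real \<times> real) set \<Rightarrow> (real \<Rightarrow> real \<Rightarrow> real) \<Rightarrow> (real \<Rightarrow> real \<Rightarrow> real) \<Rightarrow> real \<Rightarrow> real \<Rightarrow> real" where
  "transformed D0 s g \<sigma> y1 =
    (if (\<sigma>, y1) \<in> change_vars s ` D0
     then g (fst (change_vars_inv D0 s (\<sigma>, y1))) y1 * \<bar>jacobian_det (change_vars_inv D0 s) (\<sigma>, y1)\<bar>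
     else 0)"

text \<open>The classes for Structures 1 and 2, at one value \<open>\<sigma>\<close> of the statistic and simultaneously at
  almost every value; \<open>h \<sigma> y1\<close> is the conditional density of \<open>Y1\<close> under the postulated model.\<close>

definition cond_class_at ::
    "(real \<times> real) set \<Rightarrow> (real \<times> real) set \<Rightarrow> (real \<Rightarrow> real \<Rightarrow> real) \<Rightarrow> (real \<Rightarrow> real \<Rightarrow> real) \<Rightarrow>
     real \<Rightarrow> (real \<Rightarrow> real \<Rightarrow> real) set" where
  "cond_class_at D D0 s h \<sigma> =
    {g \<in> densities D. AE y1 in lborel. y1 \<in> range_Y1_given D s \<sigma> \<longrightarrow>
       transformed D0 s g \<sigma> y1 /
         (LINT u:range_Y1_given D s \<sigma>|lborel. transformed D0 s g \<sigma> u) = h \<sigma> y1}"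

definition cond_class ::
    "(real \<times> real) set \<Rightarrow> (real \<times> real) set \<Rightarrow> (real \<Rightarrow> real \<Rightarrow> real) \<Rightarrow> (real \<Rightarrow> real \<Rightarrow> real) \<Rightarrow>
     (real \<Rightarrow> real \<Rightarrow> real) set" where
  "cond_class D D0 s h =
    {g \<in> densities D. AE \<sigma> in distr (law g) borel (stat s). g \<in> cond_class_at D D0 s h \<sigma>}"

text \<open>The class for Structures 3 and 4; \<open>h\<close> is the density of \<open>Z\<close> under the postulated model.\<close>

definition marg_class ::
    "(real \<times> real) set \<Rightarrow> (real \<times> real) set \<Rightarrow> (real \<Rightarrow> real \<Rightarrow> real) \<Rightarrow> (real \<Rightarrow> real) \<Rightarrow>
     (real \<Rightarrow> real \<Rightarrow> real) set" where
  "marg_class D D0 t h =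
    {g \<in> densities D. AE z in lborel.
       (LINT y1:range_Y1 D|lborel. transformed D0 t g z y1) = h z}"

definition uniform01 :: "'w measure \<Rightarrow> ('w \<Rightarrow> real) \<Rightarrow> bool" where
  "uniform01 P U \<longleftrightarrow> U \<in> borel_measurable P \<and> distr P borel U = uniform_measure lborel {0..1}"

end

theory Submission
  imports Defs
begin

text \<open>
  The map \<open>(y0, y1) \<mapsto> (s, y1)\<close> fixes \<open>y1\<close>, so a one-dimensional substitution in \<open>y0\<close> followed by
  Tonelli shows that \<open>(S, Y1)\<close> has density \<open>transformed\<close>.  Integrating out \<open>y1\<close> gives the density
  of \<open>S\<close> (or \<open>Z\<close>), and on almost every slice the conditional law of \<open>Y1\<close> is the normalised slice of
  \<open>transformed\<close>.  Membership in an equivalence class thus says that the true law of \<open>Z\<close>, or of \<open>Y1\<close>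
  given \<open>S\<close>, equals the postulated one.  This in turn is equivalent to uniformity of \<open>F\<close> applied to
  the variable, because a distribution function that transforms a law to the uniform one is, when
  continuous, the distribution function of that law.  If the model holds then the true and
  postulated laws agree, so that case is already contained in the class.
\<close>

section \<open>The probability integral transform\<close>

lemma measure_uniform01_atMost:
  fixes u :: real
  assumes "0 \<le> u" "u \<le> 1"
  shows "measure (uniform_measure lborel {0..1}) {..u} = u"
proof -
  have "{0..1} \<inter> {..u} = {0..u}"
    using assms by auto
  then show ?thesis
    using assms by (simp add: measure_uniform_measure)
qed

lemma (in finite_borel_measure) borel_measurable_cdf [measurable]: "cdf M \<in> borel_measurable borel"
  by (rule borel_measurable_mono) (simp add: mono_def cdf_nondecreasing)

lemma (in finite_borel_measure) cdf_less_imp_less: "cdf M x < cdf M y \<Longrightarrow> x < y"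
  using cdf_nondecreasing[of y x] by linarith

lemma real_distribution_uniform01: "real_distribution (uniform_measure lborel {0..1})"
  by (auto simp: real_distribution_def real_distribution_axioms_def
      intro!: prob_space_uniform_measure)

text \<open>The limits 0 and 1 at the two ends bracket \<open>u\<close> strictly, so the
  intermediate value theorem yields a quantile. The levels 0 and 1 are left out because they may be
  approached without being attained.\<close>

lemma (in real_distribution) cdf_attains:
  assumes cont: "continuous_on UNIV (cdf M)" and "0 < u" "u < 1"
  obtains x where "cdf M x = u"
proof -
  have "eventually (\<lambda>x. cdf M x < u) at_bot"
    using order_tendstoD(2)[OF cdf_lim_at_bot \<open>0 < u\<close>] .
  then obtain a where a: "cdf M a < u"
    by (meson eventually_at_bot_linorder order_refl)
  have "eventually (\<lambda>x. u < cdf M x) at_top"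
    using order_tendstoD(1)[OF cdf_lim_at_top_prob \<open>u < 1\<close>] .
  then obtain b where b: "u < cdf M b"
    by (meson eventually_at_top_linorder order_refl)
  have "a \<le> b"
    using a b cdf_nondecreasing[of b a] by (cases "a \<le> b") auto
  then obtain x where "cdf M x = u"
    using IVT'[of "cdf M" a u b] a b continuous_on_subset[OF cont] by auto
  then show ?thesis ..
qed

text \<open>From left to right, the half-line \<open>{..z}\<close> lies between the sets where
  \<open>cdf N\<close> is below, and at most, \<open>cdf N z\<close>. The uniform law has no atoms,
  so both sets have \<open>M\<close>-measure \<open>cdf N z\<close>, and flat stretches of
  \<open>cdf N\<close> do no harm. From right to left it is the classical transform, with quantiles
  supplied by continuity.\<close>

lemma cdf_probability_integral_transform_iff:
  assumes M: "real_distribution M" and N: "real_distribution N"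
    and cont: "continuous_on UNIV (cdf N)"
  shows "distr M borel (cdf N) = uniform_measure lborel {0..1} \<longleftrightarrow> M = N"
proof -
  interpret M: real_distribution M by fact
  interpret N: real_distribution N by fact
  let ?U = "uniform_measure lborel {0..1::real}"
  interpret U: real_distribution ?U by (rule real_distribution_uniform01)
  have cdf_distr: "measure (distr M borel (cdf N)) A = measure M (cdf N -` A)"
    if "A \<in> sets borel" for A
    using that by (simp add: measure_distr)
  have cdf_le[measurable]: "{x. cdf N x \<le> u} \<in> sets borel" "{x. cdf N x < u} \<in> sets borel" for u
    by measurable
  show ?thesis
  proof
    assume unif: "distr M borel (cdf N) = ?U"
    show "M = N"
    proof (rule cdf_unique[OF M N], rule ext)
      fix z
      have b: "0 \<le> cdf N z" "cdf N z \<le> 1"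
        by (simp_all add: N.cdf_nonneg N.cdf_bounded_prob)
      have le: "measure M {x. cdf N x \<le> cdf N z} = cdf N z"
        using cdf_distr[of "{..cdf N z}"] b unfolding unif
        by (simp add: measure_uniform01_atMost vimage_def)
      have "measure ?U {..<cdf N z} = cdf N z"
      proof -
        have "{0..1} \<inter> {..<cdf N z} = {0..<cdf N z}"
          using b by auto
        then show ?thesis
          using b by (simp add: measure_uniform_measure)
      qed
      then have less: "measure M {x. cdf N x < cdf N z} = cdf N z"
        using cdf_distr[of "{..<cdf N z}"] unfolding unif by (simp add: vimage_def)
      have "measure M {..z} \<le> measure M {x. cdf N x \<le> cdf N z}"
        by (rule M.finite_measure_mono) (auto simp: N.cdf_nondecreasing)
      moreover have "measure M {x. cdf N x < cdf N z} \<le> measure M {..z}"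
        by (rule M.finite_measure_mono)
          (auto dest: N.cdf_less_imp_less)
      ultimately show "cdf M z = cdf N z"
        unfolding cdf_def2 using le less by (simp add: cdf_def2)
    qed
  next
    assume "M = N"
    have "cdf (distr N borel (cdf N)) u = cdf ?U u" for u
    proof -
      consider "u < 0" | "1 \<le> u" | "0 \<le> u" "u < 1"
        by linarith
      then show ?thesis
      proof cases
        case 1
        then have "{x. cdf N x \<le> u} = {}" "{0..1} \<inter> {..u} = {}"
          using N.cdf_nonneg order.trans not_less by (auto, smt (verit) N.cdf_nonneg)
        then show ?thesis
          by (simp add: cdf_def2 measure_distr vimage_def measure_uniform_measure)
      next
        case 2
        then have "{x. cdf N x \<le> u} = UNIV" "{0..1} \<inter> {..u} = {0..1}"
          using N.cdf_bounded_prob by (auto intro: order.trans)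
        then show ?thesis
          using N.prob_space by (simp add: cdf_def2 measure_distr vimage_def measure_uniform_measure)
      next
        case 3
        have "measure N {x. cdf N x \<le> u} \<le> u"
        \<comment> \<open>A flat stretch at level \<open>u\<close> may reach beyond a chosen
          quantile of \<open>u\<close>. A quantile of any higher level \<open>w\<close> does bound
          the set, and \<open>w\<close> then decreases to \<open>u\<close>.\<close>
        proof (rule dense_ge_bounded[OF \<open>u < 1\<close>])
          fix w assume w: "u < w" "w < 1"
          with 3 obtain z where z: "cdf N z = w"
            using N.cdf_attains[OF cont, of w] by auto
          have "measure N {x. cdf N x \<le> u} \<le> measure N {..z}"
            using w z by (intro N.finite_measure_mono)
              (auto intro: less_imp_le[OF N.cdf_less_imp_less])
          then show "measure N {x. cdf N x \<le> u} \<le> w"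
            using z by (simp add: cdf_def2)
        qed
        moreover have "u \<le> measure N {x. cdf N x \<le> u}"
        \<comment> \<open>Level 0 need not be attained, but there the bound is just nonnegativity of
          the measure.\<close>
        proof (cases "u = 0")
          case False
          with 3 obtain z where z: "cdf N z = u"
            using N.cdf_attains[OF cont, of u] by auto
          have "measure N {..z} \<le> measure N {x. cdf N x \<le> u}"
            by (intro N.finite_measure_mono) (auto simp: z dest: N.cdf_nondecreasing)
          then show ?thesis
            using z by (simp add: cdf_def2)
        qed simp
        ultimately show ?thesis
          using 3 by (simp add: cdf_def2 measure_distr vimage_def measure_uniform01_atMost)
      qed
    qed
    then show "distr M borel (cdf N) = ?U"
      unfolding \<open>M = N\<close>
      by (intro cdf_unique real_distribution_uniform01 ext) auto
  qed
qed

text \<open>\<open>pdf_of\<close> prescribes masses of half-lines only. Exhausting the line by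
  half-lines gives \<open>h\<close> total mass 1, so uniqueness of distribution functions identifies
  the measure. A measure with a Lebesgue density has no atoms, whence continuity.\<close>

lemma pdf_of_cdf:
  assumes N: "real_distribution N" and h: "pdf_of (cdf N) h"
  shows "N = density lborel (\<lambda>x. ennreal (h x))" and "continuous_on UNIV (cdf N)"
proof -
  interpret N: real_distribution N by fact
  let ?H = "density lborel (\<lambda>x. ennreal (h x))"
  have [measurable]: "h \<in> borel_measurable borel"
    and le: "emeasure ?H {..y} = ennreal (cdf N y)" for y
    using h by (auto simp: pdf_of_def)
  have "(\<lambda>n. emeasure ?H {..real n}) \<longlonglongrightarrow> emeasure ?H (\<Union>n. {..real n})"
    by (rule Lim_emeasure_incseq) (auto simp: incseq_def)
  moreover have "(\<Union>n. {..real n}) = UNIV"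
    by (auto intro: real_arch_simple)
  moreover have "(\<lambda>n. emeasure ?H {..real n}) \<longlonglongrightarrow> ennreal 1"
    unfolding le by (intro tendsto_ennrealI N.cdf_lim_infty_prob)
  ultimately have "emeasure ?H (space ?H) = 1"
    using LIMSEQ_unique by fastforce
  then have H: "real_distribution ?H"
    by (auto simp: real_distribution_def real_distribution_axioms_def intro!: prob_spaceI)
  have "cdf N = cdf ?H"
    by (simp add: fun_eq_iff cdf_def2[of ?H] measure_def le N.cdf_nonneg)
  then show eq: "N = ?H"
    using cdf_unique[OF N H] by simp
  have "emeasure ?H {x} = 0" for x
    by (subst emeasure_density) (auto simp: nn_integral_indicator_singleton' intro!: AE_I[of _ _ "{x}"] nn_integral_0_iff_AE[THEN iffD2])
  then have "isCont (cdf ?H) x" for x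
    using real_distribution.finite_borel_measure_M[OF H]
    by (subst finite_borel_measure.isCont_cdf) (auto simp: measure_def)
  then show "continuous_on UNIV (cdf N)"
    by (subst eq) (simp add: continuous_on_eq_continuous_at)
qed

section \<open>Conditional laws and joint densities\<close>

text \<open>Right-continuity determines a distribution function from its rational values.
  Restricting to countably many cut points is what lets a single null set serve all of them when
  kernels are compared almost everywhere.\<close>

lemma finite_borel_measure_eqI_rat:
  assumes M: "finite_borel_measure M" and N: "finite_borel_measure N"
    and eq: "\<And>q. q \<in> \<rat> \<Longrightarrow> emeasure M {..q} = emeasure N {..q}"
  shows "M = N"
proof (rule cdf_unique'[OF M N], rule ext)
  fix x
  \<comment> \<open>Rational points strictly above \<open>x\<close> and within \<open>1 / n\<close>
    of it; strictness is what the filter \<open>at_right x\<close> demands. At \<open>n = 0\<close>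
    the division gives 0 and the bounds may fail, so they are used only eventually.\<close>
  define q :: "nat \<Rightarrow> real" where "q n = of_int (\<lfloor>real n * x\<rfloor> + 1) / real n" for n
  have q: "x < q n" "q n \<le> x + 1 / real n" if "n > 0" for n
    using that unfolding q_def by (auto simp: field_simps) linarith+
  have "(\<lambda>n. x + 1 / real n) \<longlonglongrightarrow> x + 0"
    by (intro tendsto_intros lim_1_over_n)
  then have "q \<longlonglongrightarrow> x"
    by (intro tendsto_sandwich[of "\<lambda>_. x" q _ "\<lambda>n. x + 1 / real n"])
      (auto intro!: eventually_mono[OF eventually_gt_at_top[of 0]] q less_imp_le[OF q(1)])
  then have lim: "filterlim q (at_right x) sequentially"
    unfolding filterlim_at
    by (auto intro!: eventually_mono[OF eventually_gt_at_top[of 0]] dest: q(1))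
  have "(\<lambda>n. cdf M (q n)) \<longlonglongrightarrow> cdf M x" "(\<lambda>n. cdf N (q n)) \<longlonglongrightarrow> cdf N x"
    using finite_borel_measure.cdf_is_right_cont[OF M, of x]
      finite_borel_measure.cdf_is_right_cont[OF N, of x] lim
    unfolding continuous_within by (auto intro: filterlim_compose)
  moreover have "cdf M (q n) = cdf N (q n)" for n
  proof -
    have "q n \<in> \<rat>"
      unfolding q_def by (intro Rats_divide) auto
    then show ?thesis
      by (simp add: cdf_def2 measure_def eq)
  qed
  ultimately show "cdf M x = cdf N x"
    by (simp add: LIMSEQ_unique)
qed

lemma cond_law_real_distribution:
  fixes Y :: "'w \<Rightarrow> real"
  assumes "cond_law P X Y K"
  shows "real_distribution (K x)"
  using assms measurable_space[of K borel "prob_algebra borel" x]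
  by (auto simp: cond_law_def space_prob_algebra real_distribution_def real_distribution_axioms_def)

text \<open>Tonelli with \<open>x\<close> outermost, which puts rectangle probabilities into the
  same shape as the defining equation of \<open>cond_law\<close>.\<close>

lemma emeasure_joint_density_rectangle:
  fixes X Y :: "'w \<Rightarrow> real"
  assumes [measurable]: "X \<in> borel_measurable M" "Y \<in> borel_measurable M" "\<tau> \<in> borel_measurable borel"
    and joint: "distr M borel (\<lambda>\<omega>. (X \<omega>, Y \<omega>)) = density lborel \<tau>"
    and [measurable]: "A \<in> sets borel" "B \<in> sets borel"
  shows "emeasure M {\<omega> \<in> space M. X \<omega> \<in> A \<and> Y \<omega> \<in> B} =
      (\<integral>\<^sup>+ x. (\<integral>\<^sup>+ y. \<tau> (x, y) * indicator B y \<partial>lborel) * indicator A x \<partial>lborel)"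
proof -
  have [measurable]: "\<tau> \<in> borel_measurable (borel \<Otimes>\<^sub>M borel)"
    by (simp add: borel_prod)
  have AB: "A \<times> B \<in> sets (borel :: (real \<times> real) measure)"
    by (simp add: borel_prod[symmetric])
  have "emeasure M {\<omega> \<in> space M. X \<omega> \<in> A \<and> Y \<omega> \<in> B} =
      emeasure (distr M borel (\<lambda>\<omega>. (X \<omega>, Y \<omega>))) (A \<times> B)"
    using AB by (subst emeasure_distr) (auto intro!: arg_cong[where f="emeasure M"] simp: borel_prod[symmetric])
  also have "\<dots> = (\<integral>\<^sup>+ p. \<tau> p * indicator (A \<times> B) p \<partial>(lborel \<Otimes>\<^sub>M lborel))"
    unfolding joint using AB by (subst emeasure_density) (auto simp: lborel_prod)
  also have "\<dots> = (\<integral>\<^sup>+ x. \<integral>\<^sup>+ y. \<tau> (x, y) * indicator (A \<times> B) (x, y) \<partial>lborel \<partial>lborel)"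
    by (subst lborel.nn_integral_fst[symmetric]) (auto intro!: borel_measurable_times_ennreal borel_measurable_indicator simp: lborel_prod AB)
  also have "\<dots> = (\<integral>\<^sup>+ x. (\<integral>\<^sup>+ y. \<tau> (x, y) * indicator B y * indicator A x \<partial>lborel) \<partial>lborel)"
    by (auto intro!: nn_integral_cong simp: indicator_times mult.commute mult.left_commute)
  finally show ?thesis
    by (simp add: nn_integral_multc)
qed

lemma distr_fst_density:
  fixes X Y :: "'w \<Rightarrow> real"
  assumes [measurable]: "X \<in> borel_measurable M" "Y \<in> borel_measurable M" "\<tau> \<in> borel_measurable borel"
    and joint: "distr M borel (\<lambda>\<omega>. (X \<omega>, Y \<omega>)) = density lborel \<tau>"
  shows "distr M borel X = density lborel (\<lambda>x. \<integral>\<^sup>+ y. \<tau> (x, y) \<partial>lborel)"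
proof (rule measure_eqI)
  have [measurable]: "\<tau> \<in> borel_measurable (borel \<Otimes>\<^sub>M borel)"
    by (simp add: borel_prod)
  fix A assume "A \<in> sets (distr M borel X)"
  then have [measurable]: "A \<in> sets borel"
    by simp
  have "emeasure (distr M borel X) A = emeasure M {\<omega> \<in> space M. X \<omega> \<in> A \<and> Y \<omega> \<in> UNIV}"
    by (subst emeasure_distr) (auto intro!: arg_cong[where f="emeasure M"])
  also have "\<dots> = (\<integral>\<^sup>+ x. (\<integral>\<^sup>+ y. \<tau> (x, y) \<partial>lborel) * indicator A x \<partial>lborel)"
    by (subst emeasure_joint_density_rectangle[OF _ _ _ joint]) auto
  finally show "emeasure (distr M borel X) A =
      emeasure (density lborel (\<lambda>x. \<integral>\<^sup>+ y. \<tau> (x, y) \<partial>lborel)) A"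
    by (simp add: emeasure_density)
qed simp

text \<open>Kernel and density slices both integrate to the rectangle probabilities, so for each cut
  point they agree at almost every \<open>x\<close>, and rational cut points determine the measures.
  The unnormalised slice is compared with the kernel scaled by the marginal density, which avoids a
  division in \<open>ennreal\<close>.\<close>

lemma cond_law_eq_density:
  fixes X Y :: "'w \<Rightarrow> real" and \<tau> :: "real \<times> real \<Rightarrow> ennreal"
  assumes "prob_space M" and cond: "cond_law M X Y \<kappa>"
    and [measurable]: "\<tau> \<in> borel_measurable borel"
    and joint: "distr M borel (\<lambda>\<omega>. (X \<omega>, Y \<omega>)) = density lborel \<tau>"
  defines "k \<equiv> \<lambda>x. \<integral>\<^sup>+ y. \<tau> (x, y) \<partial>lborel"
  shows "AE x in distr M borel X. 0 < k x \<and> k x < \<infinity> \<and>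
      density lborel (\<lambda>y. \<tau> (x, y)) = density (\<kappa> x) (\<lambda>_. k x)"
proof -
  interpret prob_space M by fact
  have [measurable]: "X \<in> borel_measurable M" "Y \<in> borel_measurable M"
    and \<kappa>: "\<kappa> \<in> measurable borel (prob_algebra borel)"
    and rect: "\<And>A B. A \<in> sets borel \<Longrightarrow> B \<in> sets borel \<Longrightarrow>
      emeasure M {\<omega> \<in> space M. X \<omega> \<in> A \<and> Y \<omega> \<in> B} =
       (\<integral>\<^sup>+ x. emeasure (\<kappa> x) B * indicator A x \<partial>distr M borel X)"
    using cond by (auto simp: cond_law_def)
  have [measurable]: "\<tau> \<in> borel_measurable (borel \<Otimes>\<^sub>M borel)"
    by (simp add: borel_prod)
  have [measurable]: "k \<in> borel_measurable borel"
    unfolding k_def by measurable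
  have [measurable]: "(\<lambda>x. emeasure (\<kappa> x) B) \<in> borel_measurable borel" if "B \<in> sets borel" for B
    using measurable_compose[OF measurable_prob_algebraD[OF \<kappa>] measurable_emeasure_subprob_algebra] that .
  have rect_\<tau>: "emeasure M {\<omega> \<in> space M. X \<omega> \<in> A \<and> Y \<omega> \<in> B} =
      (\<integral>\<^sup>+ x. (\<integral>\<^sup>+ y. \<tau> (x, y) * indicator B y \<partial>lborel) * indicator A x \<partial>lborel)"
    if "A \<in> sets borel" "B \<in> sets borel" for A B
    by (rule emeasure_joint_density_rectangle[OF _ _ _ joint that]) measurable
  have X: "distr M borel X = density lborel k"
    unfolding k_def by (rule distr_fst_density[OF _ _ _ joint]) measurable
  \<comment> \<open>For a fixed half-line both sides are Lebesgue densities in \<open>x\<close> of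
    the same set function, since the rectangle identities hold for every \<open>A\<close>.\<close>
  have "AE x in lborel. (\<integral>\<^sup>+ y. \<tau> (x, y) * indicator {..q} y \<partial>lborel) = emeasure (\<kappa> x) {..q} * k x" for q
  proof (rule sigma_finite_measure.density_unique2[OF sigma_finite_lborel])
    fix A :: "real set" assume "A \<in> sets lborel"
    then have [measurable]: "A \<in> sets borel"
      by simp
    show "(\<integral>\<^sup>+ x \<in> A. (\<integral>\<^sup>+ y. \<tau> (x, y) * indicator {..q} y \<partial>lborel) \<partial>lborel) =
        (\<integral>\<^sup>+ x \<in> A. (emeasure (\<kappa> x) {..q} * k x) \<partial>lborel)"
      using trans[OF rect_\<tau>[of A "{..q}", symmetric] rect[of A "{..q}"]] unfolding X
      by (simp add: nn_integral_density mult_ac)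
  qed measurable
  then have "AE x in lborel. \<forall>q\<in>\<rat>. (\<integral>\<^sup>+ y. \<tau> (x, y) * indicator {..q} y \<partial>lborel) = emeasure (\<kappa> x) {..q} * k x"
    by (intro AE_ball_countable[THEN iffD2] countable_rat ballI)
  moreover have "AE x in lborel. k x \<noteq> \<infinity>"
  proof (rule nn_integral_PInf_AE)
    have "(\<integral>\<^sup>+ x. k x \<partial>lborel) = emeasure (density lborel k) UNIV"
      by (simp add: emeasure_density)
    also have "\<dots> \<noteq> \<infinity>"
      unfolding X[symmetric] using prob_space.emeasure_space_1[OF prob_space_distr, of X borel] by simp
    finally show "(\<integral>\<^sup>+ x. k x \<partial>lborel) \<noteq> \<infinity>" .
  qed simp
  \<comment> \<open>Points with \<open>k x = 0\<close> carry no mass under the law of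
    \<open>X\<close>, whose density is \<open>k\<close>; guarding by positivity is the form that
    \<open>AE_density\<close> converts.\<close>
  ultimately have "AE x in lborel. 0 < k x \<longrightarrow> 0 < k x \<and> k x < \<infinity> \<and>
      density lborel (\<lambda>y. \<tau> (x, y)) = density (\<kappa> x) (\<lambda>_. k x)"
  proof eventually_elim
    case (elim x)
    interpret \<kappa>: real_distribution "\<kappa> x" using cond by (rule cond_law_real_distribution)
    have mass: "emeasure (density (\<kappa> x) (\<lambda>_. k x)) {..q} = emeasure (\<kappa> x) {..q} * k x" for q
      by (simp add: emeasure_density nn_integral_cmult mult.commute)
    have "emeasure (density (\<kappa> x) (\<lambda>_. k x)) UNIV = k x"
      using \<kappa>.emeasure_space_1 by (simp add: emeasure_density)
    moreover have "emeasure (density lborel (\<lambda>y. \<tau> (x, y))) UNIV = k x"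
      by (simp add: emeasure_density k_def)
    ultimately have fin: "finite_borel_measure (density lborel (\<lambda>y. \<tau> (x, y)))"
        "finite_borel_measure (density (\<kappa> x) (\<lambda>_. k x))"
      using elim(2) by (auto simp: finite_borel_measure_def finite_borel_measure_axioms_def intro!: finite_measureI)
    have "density lborel (\<lambda>y. \<tau> (x, y)) = density (\<kappa> x) (\<lambda>_. k x)"
    proof (rule finite_borel_measure_eqI_rat[OF fin])
      fix q :: real assume "q \<in> \<rat>"
      then show "emeasure (density lborel (\<lambda>y. \<tau> (x, y))) {..q} = emeasure (density (\<kappa> x) (\<lambda>_. k x)) {..q}"
        using elim(1) unfolding mass by (simp add: emeasure_density)
    qed
    then show ?case
      using elim(2) by (simp add: less_top[symmetric])
  qed
  then show "AE x in distr M borel X. 0 < k x \<and> k x < \<infinity> \<and>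
      density lborel (\<lambda>y. \<tau> (x, y)) = density (\<kappa> x) (\<lambda>_. k x)"
    unfolding X by (rule AE_density[THEN iffD2, rotated]) simp
qed

section \<open>Change of variables along the fibres\<close>

text \<open>Splits a nonnegative integral into integrability and Bochner value, the two things that
  the change of variables for absolutely integrable functions transfers.\<close>

lemma nn_integral_real_eq:
  fixes f :: "'a \<Rightarrow> real"
  assumes "f \<in> borel_measurable M" "\<And>x. 0 \<le> f x"
  shows "(\<integral>\<^sup>+ x. ennreal (f x) \<partial>M) = (if integrable M f then ennreal (integral\<^sup>L M f) else \<infinity>)"
  using assms by (auto simp: nn_integral_eq_integral integrable_iff_bounded not_less top_unique)

text \<open>Integrability passes both ways through the substitution, so the two nonnegative
  integrals are infinite together or finite and equal. Borel measurability of the integrands brings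
  the result from Lebesgue measure on the completed sigma-algebra back to
  \<open>lborel\<close>.\<close>

lemma nn_integral_change_of_variables_1:
  fixes \<phi> \<phi>' f :: "real \<Rightarrow> real"
  assumes S: "S \<in> sets borel" and der: "\<And>x. x \<in> S \<Longrightarrow> (\<phi> has_field_derivative \<phi>' x) (at x)"
    and inj: "inj_on \<phi> S" and nonneg: "\<And>x. 0 \<le> f x"
    and meas: "(\<lambda>x. indicator (\<phi> ` S) x * f x) \<in> borel_measurable borel"
      "(\<lambda>x. indicator S x * (\<bar>\<phi>' x\<bar> * f (\<phi> x))) \<in> borel_measurable borel"
  shows "(\<integral>\<^sup>+ x. ennreal (indicator (\<phi> ` S) x * f x) \<partial>lborel) =
    (\<integral>\<^sup>+ x. ennreal (indicator S x * (\<bar>\<phi>' x\<bar> * f (\<phi> x))) \<partial>lborel)"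
proof -
  have meas': "(\<lambda>x. indicator (\<phi> ` S) x * f x) \<in> borel_measurable lebesgue"
      "(\<lambda>x. indicator S x * (\<bar>\<phi>' x\<bar> * f (\<phi> x))) \<in> borel_measurable lebesgue"
    using meas by (auto intro: measurable_completion)
  have S': "S \<in> sets lebesgue"
    using S by auto
  let ?F = "\<lambda>x. \<bar>\<phi>' x\<bar> * f (\<phi> x)"
  \<comment> \<open>With \<open>b\<close> free, taking it to be either integral gives the
    equivalence of integrability as well as equality of values.\<close>
  have cov: "?F absolutely_integrable_on S \<and> integral S ?F = b
     \<longleftrightarrow> f absolutely_integrable_on (\<phi> ` S) \<and> integral (\<phi> ` S) f = b" for b
    by (rule has_absolute_integral_change_of_variables_1'[OF S' has_field_derivative_at_within[OF der] inj])
  have 1: "?F absolutely_integrable_on S \<longleftrightarrow> f absolutely_integrable_on (\<phi> ` S)"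
    using cov by blast
  have "(LINT x|lebesgue. indicator S x * ?F x) = (LINT x|lebesgue. indicator (\<phi> ` S) x * f x)"
    if "f absolutely_integrable_on (\<phi> ` S)"
    using cov[of "integral (\<phi> ` S) f"] that set_lebesgue_integral_eq_integral(2)[OF that] 1
      set_lebesgue_integral_eq_integral(2)[of S ?F]
    by (simp add: set_lebesgue_integral_def)
  then have "(\<integral>\<^sup>+ x. ennreal (indicator (\<phi> ` S) x * f x) \<partial>lebesgue) =
    (\<integral>\<^sup>+ x. ennreal (indicator S x * ?F x) \<partial>lebesgue)"
    using 1 meas' nonneg by (subst (1 2) nn_integral_real_eq) (auto simp: set_integrable_def)
  then show ?thesis
    by (simp add: nn_integral_completion)
qed

lemma directional_derivative_limit:
  fixes f :: "'a::real_normed_vector \<Rightarrow> real"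
  assumes "(f has_derivative A) (at p)"
  shows "((\<lambda>t. f (p + t *\<^sub>R v)) has_field_derivative A v) (at 0)"
proof -
  have "((\<lambda>t. p + t *\<^sub>R v) has_derivative (\<lambda>t. t *\<^sub>R v)) (at (0::real))"
    by (auto intro!: derivative_eq_intros)
  then have "((\<lambda>t. f (p + t *\<^sub>R v)) has_derivative (\<lambda>t. A (t *\<^sub>R v))) (at 0)"
    using has_derivative_compose[of "\<lambda>t. p + t *\<^sub>R v" "\<lambda>t. t *\<^sub>R v" 0 UNIV f A] assms by simp
  moreover have "A (t *\<^sub>R v) = A v * t" for t
    using linear_scale[OF has_derivative_linear[OF assms]] by simp
  ultimately show ?thesis
    by (simp add: has_field_derivative_def)
qed

text \<open>The derivative need not be continuous, but it is a pointwise limit of difference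
  quotients with steps \<open>1 / Suc n\<close>. Extending \<open>f\<close> by 0 off
  \<open>V\<close> makes the quotients globally Borel, and openness of \<open>V\<close> makes the
  extension invisible in the limit.\<close>

lemma borel_measurable_directional_derivative:
  fixes f :: "'a::euclidean_space \<Rightarrow> real"
  assumes V: "open V" and der: "\<And>p. p \<in> V \<Longrightarrow> (f has_derivative A p) (at p)"
  shows "(\<lambda>p. indicator V p * A p v) \<in> borel_measurable borel"
proof (rule borel_measurable_LIMSEQ_real)
  let ?h = "\<lambda>p. indicator V p * f p"
  let ?Q = "\<lambda>n p. indicator V p * ((?h (p + (1 / real (Suc n)) *\<^sub>R v) - ?h p) / (1 / real (Suc n)))"
  have [measurable]: "V \<in> sets borel"
    using V by simp
  have "continuous_on V f"
    by (meson der continuous_at_imp_continuous_on has_derivative_continuous)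
  then have [measurable]: "?h \<in> borel_measurable borel"
    using borel_measurable_continuous_on_indicator[of V f] by simp
  show "?Q n \<in> borel_measurable borel" for n
    by measurable
  show "(\<lambda>n. ?Q n p) \<longlonglongrightarrow> indicator V p * A p v" for p
  proof (cases "p \<in> V")
    case True
    have "(\<lambda>h. (f (p + h *\<^sub>R v) - f p) / h) \<midarrow>0\<rightarrow> A p v"
      using directional_derivative_limit[OF der[OF True], of v] by (simp add: DERIV_def)
    moreover have 0: "filterlim (\<lambda>n. 1 / real (Suc n)) (at 0) sequentially"
      unfolding filterlim_at using LIMSEQ_Suc[OF lim_1_over_n] by (auto simp: filterlim_def)
    ultimately have "(\<lambda>n. (f (p + (1 / real (Suc n)) *\<^sub>R v) - f p) / (1 / real (Suc n))) \<longlonglongrightarrow> A p v"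
      by (rule filterlim_compose)
    moreover have "eventually (\<lambda>n. p + (1 / real (Suc n)) *\<^sub>R v \<in> V) sequentially"
    proof -
      have "(\<lambda>n. p + (1 / real (Suc n)) *\<^sub>R v) \<longlonglongrightarrow> p + 0 *\<^sub>R v"
        by (intro tendsto_intros LIMSEQ_Suc[OF lim_1_over_n])
      then show ?thesis
        using topological_tendstoD[of _ p sequentially V] V True by simp
    qed
    then have "eventually (\<lambda>n. (f (p + (1 / real (Suc n)) *\<^sub>R v) - f p) / (1 / real (Suc n)) = ?Q n p) sequentially"
      by eventually_elim (use True in simp)
    ultimately show ?thesis
      using True tendsto_cong by (auto intro: Lim_transform_eventually)
  qed simp
qed

section \<open>The change of variables on its regular set, its inverse and its Jacobian\<close>

locale fibred_change_vars =
  fixes D D0 :: "(real \<times> real) set" and s :: "real \<Rightarrow> real \<Rightarrow> real"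
  assumes regular: "regular_change_vars D D0 s"
    and measurable_stat [measurable]: "stat s \<in> borel_measurable borel"
begin

abbreviation "V \<equiv> change_vars s ` D0"
abbreviation "\<phi> \<equiv> change_vars_inv D0 s"

lemma open_D0: "open D0" and D0_subset: "D0 \<subseteq> D" and null_D_D0: "D - D0 \<in> null_sets lborel"
  and inj_change_vars: "inj_on (change_vars s) D0"
  and differentiable_change_vars: "change_vars s differentiable_on D0"
  and differentiable_inv: "\<phi> differentiable_on V"
  using regular by (auto simp: regular_change_vars_def)

text \<open>Openness makes \<open>V\<close> Borel and gives the inverse a full Frechet derivative at
  each of its points.\<close>

lemma open_V: "open V"
  using differentiable_imp_continuous_on[OF differentiable_change_vars] open_D0 inj_change_vars
  by (rule invariance_of_domain)

lemma inv_change_vars [simp]: "q \<in> D0 \<Longrightarrow> \<phi> (change_vars s q) = q"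
  by (simp add: change_vars_inv_def the_inv_into_f_f inj_change_vars)

lemma inv_in_D0: "p \<in> V \<Longrightarrow> \<phi> p \<in> D0"
  by auto

lemma change_vars_of_inv: "p \<in> V \<Longrightarrow> change_vars s (\<phi> p) = p"
  by auto

lemma snd_inv: "p \<in> V \<Longrightarrow> snd (\<phi> p) = snd p"
  using arg_cong[OF change_vars_of_inv, of p snd] by (simp add: change_vars_def split_beta)

lemma stat_inv: "p \<in> V \<Longrightarrow> s (snd p) (fst (\<phi> p)) = fst p"
  using arg_cong[OF change_vars_of_inv, of p fst] snd_inv[of p] by (simp add: change_vars_def split_beta)

lemma inv_eq: "(\<sigma>, y) \<in> V \<Longrightarrow> \<phi> (\<sigma>, y) = (fst (\<phi> (\<sigma>, y)), y)"
  using snd_inv by (metis prod.collapse snd_conv)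

lemma has_derivative_inv:
  assumes "p \<in> V"
  shows "(\<phi> has_derivative frechet_derivative \<phi> (at p)) (at p)"
  using differentiable_inv assms open_V
  by (metis differentiable_on_eq_differentiable_at frechet_derivative_works)

text \<open>The inverse fixes the second coordinate, so the second row of its derivative is (0, 1)
  and the determinant collapses to the partial derivative of \<open>y0\<close> in the statistic.
  This is why a one-dimensional substitution suffices.\<close>

lemma jacobian_det_inv:
  assumes "p \<in> V"
  shows "jacobian_det \<phi> p = fst (frechet_derivative \<phi> (at p) (1, 0))"
proof -
  let ?A = "frechet_derivative \<phi> (at p)"
  have "((\<lambda>q. snd (\<phi> q)) has_derivative (\<lambda>x. snd (?A x))) (at p)"
    by (rule has_derivative_snd[OF has_derivative_inv[OF assms]])
  \<comment> \<open>The second coordinate of \<phi> agrees with \<open>snd\<close> only on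
    \<open>V\<close>; on an open set that is enough to transport the derivative, which is then
    unique.\<close>
  then have "(snd has_derivative (\<lambda>x. snd (?A x))) (at p)"
    by (rule has_derivative_transform_within_open[OF _ open_V assms snd_inv])
  moreover have "(snd has_derivative snd) (at p)"
    by (rule bounded_linear_imp_has_derivative[OF bounded_linear_snd])
  ultimately have "(\<lambda>x. snd (?A x)) = snd"
    by (rule has_derivative_unique)
  then have "snd (?A x) = snd x" for x
    by metis
  then show ?thesis
    by (simp add: jacobian_det_def)
qed

lemma has_field_derivative_inv:
  assumes "(\<sigma>, y) \<in> V"
  shows "((\<lambda>\<sigma>. fst (\<phi> (\<sigma>, y))) has_field_derivative jacobian_det \<phi> (\<sigma>, y)) (at \<sigma>)"
proof -
  have "((\<lambda>t. fst (\<phi> ((\<sigma>, y) + t *\<^sub>R (1, 0)))) has_field_derivative jacobian_det \<phi> (\<sigma>, y)) (at 0)"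
    unfolding jacobian_det_inv[OF assms]
    by (rule directional_derivative_limit[OF has_derivative_fst[OF has_derivative_inv[OF assms]]])
  then show ?thesis
    using DERIV_shift[of "\<lambda>\<sigma>. fst (\<phi> (\<sigma>, y))" _ 0 \<sigma>] by (simp add: add.commute)
qed

lemma borel_measurable_jacobian:
  "(\<lambda>p. indicator V p * jacobian_det \<phi> p) \<in> borel_measurable borel"
proof -
  have "(\<lambda>p. indicator V p * fst (frechet_derivative \<phi> (at p) (1, 0))) \<in> borel_measurable borel"
    by (rule borel_measurable_directional_derivative[OF open_V has_derivative_fst[OF has_derivative_inv]])
  moreover have "(\<lambda>p. indicator V p * fst (frechet_derivative \<phi> (at p) (1, 0))) =
      (\<lambda>p. indicator V p * jacobian_det \<phi> p)"
    by (auto simp: fun_eq_iff indicator_def jacobian_det_inv)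
  ultimately show ?thesis
    by simp
qed

lemma transformed_nonneg: "(\<And>y0 y1. 0 \<le> g y0 y1) \<Longrightarrow> 0 \<le> transformed D0 s g \<sigma> y"
  by (simp add: transformed_def)

lemma transformed_eq_0: "(\<sigma>, y) \<notin> V \<Longrightarrow> transformed D0 s g \<sigma> y = 0"
  by (simp add: transformed_def)

lemma borel_measurable_transformed:
  assumes "(\<lambda>(y0, y1). g y0 y1) \<in> borel_measurable borel"
  shows "(\<lambda>(\<sigma>, y). transformed D0 s g \<sigma> y) \<in> borel_measurable borel"
proof -
  have [measurable]: "V \<in> sets borel"
    using open_V by simp
  have [measurable]: "(\<lambda>p. indicator V p * jacobian_det \<phi> p) \<in> borel_measurable borel"
    by (rule borel_measurable_jacobian)
  have [measurable]: "(\<lambda>p. indicator V p *\<^sub>R \<phi> p) \<in> borel_measurable borel"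
    using borel_measurable_continuous_on_indicator[OF _ differentiable_imp_continuous_on[OF differentiable_inv]] by simp
  have [measurable]: "case_prod g \<in> borel_measurable borel"
    using assms by simp
  \<comment> \<open>Each factor is cut off to 0 outside \<open>V\<close> and so is globally Borel;
    the value of \<open>g\<close> at the cut-off point is irrelevant because the outer indicator
    vanishes there.\<close>
  have "(\<lambda>p. indicator V p * case_prod g (indicator V p *\<^sub>R \<phi> p) * \<bar>indicator V p * jacobian_det \<phi> p\<bar>)
      \<in> borel_measurable borel"
    by measurable
  moreover have "(\<lambda>p. indicator V p * case_prod g (indicator V p *\<^sub>R \<phi> p) * \<bar>indicator V p * jacobian_det \<phi> p\<bar>)
      = (\<lambda>(\<sigma>, y). transformed D0 s g \<sigma> y)"
    by (auto simp: fun_eq_iff transformed_def indicator_def abs_mult snd_inv split: prod.split dest!: inv_eq)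
  ultimately show ?thesis
    by simp
qed

end

text \<open>Removes the marginal factor left over by \<open>cond_law_eq_density\<close>;
  multiplication in \<open>ennreal\<close> is cancellable only by positive finite constants.\<close>

lemma density_const_cancel:
  assumes "0 < k" "k < (\<infinity> :: ennreal)" "sets M = sets N"
  shows "density M (\<lambda>_. k) = density N (\<lambda>_. k) \<longleftrightarrow> M = N"
proof
  assume eq: "density M (\<lambda>_. k) = density N (\<lambda>_. k)"
  show "M = N"
  proof (rule measure_eqI[OF assms(3)])
    fix A assume "A \<in> sets M"
    then have "k * emeasure M A = k * emeasure N A"
      using arg_cong[OF eq, of "\<lambda>L. emeasure L A"] assms(3) by (simp add: emeasure_density_const)
    then show "emeasure M A = emeasure N A"
      using assms(1,2) by (auto simp: ennreal_mult_cancel_left)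
  qed
qed simp

lemma uniform01_cdf_iff:
  assumes M: "real_distribution M" and N: "real_distribution N" and "continuous_on UNIV (cdf N)"
  shows "uniform01 M (cdf N) \<longleftrightarrow> M = N"
proof -
  interpret M: real_distribution M by fact
  interpret N: real_distribution N by fact
  show ?thesis
    using cdf_probability_integral_transform_iff[OF assms] by (simp add: uniform01_def)
qed

lemma densitiesD:
  assumes "g \<in> densities D"
  shows "(\<lambda>(y0, y1). g y0 y1) \<in> borel_measurable borel" "0 \<le> g y0 y1"
    "(y0, y1) \<notin> D \<Longrightarrow> g y0 y1 = 0" "prob_space (law g)"
proof -
  show [measurable]: "(\<lambda>(y0, y1). g y0 y1) \<in> borel_measurable borel"
    using assms by (simp add: densities_def)
  show "0 \<le> g y0 y1" "(y0, y1) \<notin> D \<Longrightarrow> g y0 y1 = 0"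
    using assms by (auto simp: densities_def)
  have "(\<lambda>(y0, y1). ennreal (g y0 y1)) \<in> borel_measurable borel"
    using measurable_compose[OF _ measurable_ennreal, of "\<lambda>(y0, y1). g y0 y1" borel]
    by (simp add: split_beta)
  then show "prob_space (law g)"
    using assms by (intro prob_spaceI) (auto simp: law_def densities_def emeasure_density)
qed

section \<open>The joint law of the statistic and the second coordinate\<close>

context fibred_change_vars
begin

text \<open>On the fibre at \<open>y\<close> the inverse maps the slice of \<open>V\<close>
  injectively onto the slice of \<open>D0\<close>, with the Jacobian as its derivative. Along it the
  statistic equals the new variable, so the test on \<open>s y y0\<close> becomes a test on
  \<sigma>.\<close>

lemma nn_integral_fibre:
  assumes g: "g \<in> densities D" and A [measurable]: "A \<in> sets borel"
  shows "(\<integral>\<^sup>+ y0. ennreal (g y0 y) * indicator D0 (y0, y) * indicator A (s y y0) \<partial>lborel) =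
    (\<integral>\<^sup>+ \<sigma>. ennreal (transformed D0 s g \<sigma> y) * indicator A \<sigma> \<partial>lborel)"
proof -
  let ?S = "{\<sigma>. (\<sigma>, y) \<in> V}"
  let ?\<phi> = "\<lambda>\<sigma>. fst (\<phi> (\<sigma>, y))"
  let ?f = "\<lambda>y0. g y0 y * indicator A (s y y0)"
  have slice: "(\<lambda>x. (x, y)) \<in> measurable borel (borel :: (real \<times> real) measure)"
    unfolding borel_prod[symmetric] by measurable
  have [measurable]: "(\<lambda>y0. s y y0) \<in> borel_measurable borel" "(\<lambda>y0. g y0 y) \<in> borel_measurable borel"
      "(\<lambda>\<sigma>. transformed D0 s g \<sigma> y) \<in> borel_measurable borel"
    using measurable_compose[OF slice measurable_stat] measurable_compose[OF slice densitiesD(1)[OF g]]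
      measurable_compose[OF slice borel_measurable_transformed[OF densitiesD(1)[OF g]]]
    by (simp_all add: stat_def)
  have [measurable]: "{y0. (y0, y) \<in> D0} \<in> sets borel" "?S \<in> sets borel"
    using measurable_sets[OF slice, of D0] measurable_sets[OF slice, of V] open_D0 open_V
    by (auto simp: vimage_def)
  have image: "?\<phi> ` ?S = {y0. (y0, y) \<in> D0}"
  proof (intro equalityI subsetI)
    fix y0 assume "y0 \<in> ?\<phi> ` ?S"
    then obtain \<sigma> where "(\<sigma>, y) \<in> V" "y0 = ?\<phi> \<sigma>"
      by auto
    then show "y0 \<in> {y0. (y0, y) \<in> D0}"
      using inv_in_D0[of "(\<sigma>, y)"] inv_eq[of \<sigma> y] by simp
  next
    fix y0 assume "y0 \<in> {y0. (y0, y) \<in> D0}"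
    then have y0: "(y0, y) \<in> D0"
      by simp
    then have "(s y y0, y) \<in> V" "\<phi> (s y y0, y) = (y0, y)"
      using inv_change_vars[OF y0] by (force simp: change_vars_def)+
    then show "y0 \<in> ?\<phi> ` ?S"
      by (intro image_eqI[of _ _ "s y y0"]) auto
  qed
  \<comment> \<open>The statistic is a left inverse: it recovers \<sigma> from
    \<open>y0\<close>.\<close>
  have inj: "inj_on ?\<phi> ?S"
  proof (rule inj_onI)
    fix \<sigma> \<sigma>' assume "\<sigma> \<in> ?S" "\<sigma>' \<in> ?S" "?\<phi> \<sigma> = ?\<phi> \<sigma>'"
    then show "\<sigma> = \<sigma>'"
      using stat_inv[of "(\<sigma>, y)"] stat_inv[of "(\<sigma>', y)"] by simp
  qed
  have integrand: "indicator ?S \<sigma> * (\<bar>jacobian_det \<phi> (\<sigma>, y)\<bar> * ?f (?\<phi> \<sigma>)) =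
      transformed D0 s g \<sigma> y * indicator A \<sigma>" for \<sigma>
    using stat_inv[of "(\<sigma>, y)"] by (simp add: transformed_def indicator_def)
  have "(\<integral>\<^sup>+ y0. ennreal (g y0 y) * indicator D0 (y0, y) * indicator A (s y y0) \<partial>lborel) =
      (\<integral>\<^sup>+ y0. ennreal (indicator (?\<phi> ` ?S) y0 * ?f y0) \<partial>lborel)"
    unfolding image by (intro nn_integral_cong) (auto simp: indicator_def)
  also have "\<dots> = (\<integral>\<^sup>+ \<sigma>. ennreal (indicator ?S \<sigma> * (\<bar>jacobian_det \<phi> (\<sigma>, y)\<bar> * ?f (?\<phi> \<sigma>))) \<partial>lborel)"
  proof (rule nn_integral_change_of_variables_1[where \<phi> = ?\<phi> and f = ?f and S = ?S, OF _ _ inj])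
    show "(?\<phi> has_field_derivative jacobian_det \<phi> (\<sigma>, y)) (at \<sigma>)" if "\<sigma> \<in> ?S" for \<sigma>
      using that by (auto intro: has_field_derivative_inv)
    show "(\<lambda>y0. indicator (?\<phi> ` ?S) y0 * ?f y0) \<in> borel_measurable borel"
      unfolding image by measurable
    show "(\<lambda>\<sigma>. indicator ?S \<sigma> * (\<bar>jacobian_det \<phi> (\<sigma>, y)\<bar> * ?f (?\<phi> \<sigma>))) \<in> borel_measurable borel"
      unfolding integrand by measurable
  qed (auto simp: densitiesD(2)[OF g])
  also have "\<dots> = (\<integral>\<^sup>+ \<sigma>. ennreal (transformed D0 s g \<sigma> y) * indicator A \<sigma> \<partial>lborel)"
    unfolding integrand by (intro nn_integral_cong) (auto simp: indicator_def)
  finally show ?thesis .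
qed

lemma borel_measurable_ennreal_transformed:
  assumes "g \<in> densities D"
  shows "(\<lambda>(\<sigma>, y). ennreal (transformed D0 s g \<sigma> y)) \<in> borel_measurable borel"
  using measurable_compose[OF borel_measurable_transformed[OF densitiesD(1)[OF assms]] measurable_ennreal]
  by (simp add: split_beta)

lemma distr_law:
  assumes g: "g \<in> densities D"
  shows "distr (law g) borel (\<lambda>p. (stat s p, snd p)) =
    density lborel (\<lambda>(\<sigma>, y). ennreal (transformed D0 s g \<sigma> y))"
proof (rule measure_eqI)
  fix C assume "C \<in> sets (distr (law g) borel (\<lambda>p. (stat s p, snd p)))"
  then have C [measurable]: "C \<in> sets borel"
    by simp
  then have [measurable]: "C \<in> sets (borel \<Otimes>\<^sub>M borel)"
    unfolding borel_prod .
  let ?g = "\<lambda>p. ennreal (case_prod g p)"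
  have [measurable]: "case_prod g \<in> borel_measurable borel"
    using densitiesD(1)[OF g] by simp
  have [measurable]: "?g \<in> borel_measurable borel"
    by measurable
  have [measurable]: "D0 \<in> sets borel"
    using open_D0 by simp
  have stat': "(\<lambda>p. (stat s p, snd p)) \<in> measurable borel (borel :: (real \<times> real) measure)"
  proof -
    have "snd \<in> borel_measurable (borel :: (real \<times> real) measure)"
      by (intro borel_measurable_continuous_onI continuous_intros)
    then show ?thesis
      by measurable
  qed
  let ?C = "(\<lambda>p. (stat s p, snd p)) -` C"
  have [measurable]: "?C \<in> sets borel"
    using measurable_sets[OF stat', of C] by simp
  let ?F = "\<lambda>p. ?g p * indicator D0 p * indicator ?C p"
  let ?T = "\<lambda>p. (\<lambda>(\<sigma>, y). ennreal (transformed D0 s g \<sigma> y)) p * indicator C p"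
  have law: "law g = density lborel ?g"
    by (simp add: law_def split_beta')
  have F: "?F \<in> borel_measurable (lborel \<Otimes>\<^sub>M lborel)"
    unfolding lborel_prod measurable_lborel1 by measurable
  note borel_measurable_ennreal_transformed[OF g, measurable]
  have T: "?T \<in> borel_measurable (lborel \<Otimes>\<^sub>M lborel)"
    unfolding lborel_prod measurable_lborel1 by measurable
  have "emeasure (distr (law g) borel (\<lambda>p. (stat s p, snd p))) C = emeasure (density lborel ?g) ?C"
    using stat' by (subst emeasure_distr) (auto simp: law)
  also have "\<dots> = (\<integral>\<^sup>+ p. ?g p * indicator ?C p \<partial>lborel)"
    by (simp add: emeasure_density)
  \<comment> \<open>\<open>g\<close> vanishes off \<open>D\<close> and \<open>D - D0\<close> is
    null, so restricting to \<open>D0\<close> costs nothing.\<close>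
  also have "\<dots> = (\<integral>\<^sup>+ p. ?F p \<partial>lborel)"
  proof (rule nn_integral_cong_AE)
    show "AE p in lborel. ?g p * indicator ?C p = ?F p"
      using AE_not_in[OF null_D_D0]
    proof eventually_elim
      case (elim p)
      then show ?case
        using densitiesD(3)[OF g, of "fst p" "snd p"] by (auto simp: indicator_def split_beta)
    qed
  qed
  \<comment> \<open>Integrate over \<open>y0\<close> first, because the substitution acts with
    \<open>y\<close> held fixed.\<close>
  also have "\<dots> = (\<integral>\<^sup>+ y. \<integral>\<^sup>+ y0. ?F (y0, y) \<partial>lborel \<partial>lborel)"
    using lborel_pair.nn_integral_snd[OF F] by (simp add: lborel_prod)
  also have "\<dots> = (\<integral>\<^sup>+ y. \<integral>\<^sup>+ \<sigma>. ?T (\<sigma>, y) \<partial>lborel \<partial>lborel)"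
  proof (rule nn_integral_cong)
    fix y :: real
    have "{\<sigma>. (\<sigma>, y) \<in> C} \<in> sets borel"
      by measurable
    from nn_integral_fibre[OF g this, of y]
    show "(\<integral>\<^sup>+ y0. ?F (y0, y) \<partial>lborel) = (\<integral>\<^sup>+ \<sigma>. ?T (\<sigma>, y) \<partial>lborel)"
      by (simp add: indicator_def stat_def)
  qed
  also have "\<dots> = (\<integral>\<^sup>+ p. ?T p \<partial>lborel)"
    using lborel_pair.nn_integral_snd[OF T] by (simp add: lborel_prod)
  also have "\<dots> = emeasure (density lborel (\<lambda>(\<sigma>, y). ennreal (transformed D0 s g \<sigma> y))) C"
    by (subst emeasure_density) auto
  finally show "emeasure (distr (law g) borel (\<lambda>p. (stat s p, snd p))) C =
      emeasure (density lborel (\<lambda>(\<sigma>, y). ennreal (transformed D0 s g \<sigma> y))) C" .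
qed simp

lemma borel_measurable_transformed_slice:
  assumes "g \<in> densities D"
  shows "(\<lambda>y. transformed D0 s g \<sigma> y) \<in> borel_measurable borel"
    "(\<lambda>\<sigma>. transformed D0 s g \<sigma> y) \<in> borel_measurable borel"
proof -
  have slice: "(\<lambda>y. (\<sigma>, y)) \<in> measurable borel (borel :: (real \<times> real) measure)"
      "(\<lambda>\<sigma>. (\<sigma>, y)) \<in> measurable borel (borel :: (real \<times> real) measure)" for \<sigma> y
    unfolding borel_prod[symmetric] by measurable
  show "(\<lambda>y. transformed D0 s g \<sigma> y) \<in> borel_measurable borel"
    "(\<lambda>\<sigma>. transformed D0 s g \<sigma> y) \<in> borel_measurable borel"
    using measurable_compose[OF slice(1) borel_measurable_transformed[OF densitiesD(1)[OF assms]]]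
      measurable_compose[OF slice(2) borel_measurable_transformed[OF densitiesD(1)[OF assms]]]
    by simp_all
qed

section \<open>The density of the statistic, and the equivalence classes as equalities of
  laws\<close>

abbreviation stat_density :: "(real \<Rightarrow> real \<Rightarrow> real) \<Rightarrow> real \<Rightarrow> ennreal" where
  "stat_density g \<sigma> \<equiv> \<integral>\<^sup>+ y. ennreal (transformed D0 s g \<sigma> y) \<partial>lborel"

text \<open>The integrand vanishes off \<open>V\<close>, so any range containing the slice of
  \<open>V\<close> gives the full integral; this covers both \<open>range_Y1\<close> and
  \<open>range_Y1_given\<close>. In the infinite case both sides are 0 by convention.\<close>

lemma LINT_transformed:
  assumes g: "g \<in> densities D" and R: "\<And>y. (\<sigma>, y) \<in> V \<Longrightarrow> y \<in> R"
  shows "(LINT y:R|lborel. transformed D0 s g \<sigma> y) =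
    enn2real (stat_density g \<sigma>)"
proof -
  have "(LINT y:R|lborel. transformed D0 s g \<sigma> y) = (LINT y|lborel. transformed D0 s g \<sigma> y)"
    unfolding set_lebesgue_integral_def
    using R by (intro Bochner_Integration.integral_cong)
      (auto simp: indicator_def intro!: transformed_eq_0[symmetric] transformed_eq_0)
  also have "\<dots> = enn2real (stat_density g \<sigma>)"
    using borel_measurable_transformed_slice(1)[OF g] transformed_nonneg[OF densitiesD(2)[OF g]]
    by (intro integral_eq_nn_integral) auto
  finally show ?thesis .
qed

lemma LINT_range_Y1:
  assumes "g \<in> densities D"
  shows "(LINT y:range_Y1 D|lborel. transformed D0 s g \<sigma> y) =
    enn2real (stat_density g \<sigma>)"
  using D0_subset by (intro LINT_transformed[OF assms]) (force simp: range_Y1_def change_vars_def)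

lemma in_range_Y1_given:
  assumes "(\<sigma>, y) \<in> V"
  shows "y \<in> range_Y1_given D s \<sigma>"
  using assms D0_subset by (auto simp: range_Y1_given_def change_vars_def)

lemma measurable_stat_law: "stat s \<in> borel_measurable (law g)" "snd \<in> borel_measurable (law g)"
proof -
  have "snd \<in> borel_measurable (borel :: (real \<times> real) measure)"
    by (intro borel_measurable_continuous_onI continuous_intros)
  then show "stat s \<in> borel_measurable (law g)" "snd \<in> borel_measurable (law g)"
    by (simp_all add: law_def)
qed

lemma distr_stat:
  assumes g: "g \<in> densities D"
  shows "distr (law g) borel (stat s) =
    density lborel (stat_density g)"
  using distr_fst_density[OF measurable_stat_law borel_measurable_ennreal_transformed[OF g] distr_law[OF g]]
  by simp

lemma real_distribution_stat:
  assumes "g \<in> densities D"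
  shows "real_distribution (distr (law g) borel (stat s))"
  using prob_space.real_distribution_distr[OF densitiesD(4)[OF assms]] measurable_stat_law by auto

text \<open>Almost-everywhere uniqueness of densities. The class uses a real integral, which reads
  an infinite value as 0; the translation back works because the marginal density has mass 1 and is
  therefore finite almost everywhere.\<close>

lemma distr_stat_eq_iff_marg_class:
  assumes g: "g \<in> densities D" and N: "real_distribution N" and h: "pdf_of (cdf N) h"
  shows "distr (law g) borel (stat s) = N \<longleftrightarrow> g \<in> marg_class D D0 s h"
proof -
  let ?k = "stat_density g"
  have [measurable]: "(\<lambda>(\<sigma>, y). ennreal (transformed D0 s g \<sigma> y)) \<in> borel_measurable (borel \<Otimes>\<^sub>M borel)"
    using borel_measurable_ennreal_transformed[OF g] by (simp add: borel_prod)
  have [measurable]: "?k \<in> borel_measurable borel"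
    by measurable
  have [measurable]: "h \<in> borel_measurable borel" and h0: "\<And>y. 0 \<le> h y"
    using h by (auto simp: pdf_of_def)
  have "emeasure (distr (law g) borel (stat s)) UNIV = 1"
    using real_distribution_stat[OF g] prob_space.emeasure_space_1
    by (fastforce simp: real_distribution_def)
  then have "(\<integral>\<^sup>+ \<sigma>. ?k \<sigma> \<partial>lborel) = 1"
    unfolding distr_stat[OF g] by (simp add: emeasure_density)
  then have fin: "AE \<sigma> in lborel. ?k \<sigma> \<noteq> \<infinity>"
    by (intro nn_integral_PInf_AE) auto
  have "distr (law g) borel (stat s) = N \<longleftrightarrow> density lborel ?k = density lborel (\<lambda>\<sigma>. ennreal (h \<sigma>))"
    unfolding distr_stat[OF g] using pdf_of_cdf(1)[OF N h] by simp
  also have "\<dots> \<longleftrightarrow> (AE \<sigma> in lborel. ?k \<sigma> = ennreal (h \<sigma>))"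
    by (rule sigma_finite_measure.density_unique_iff[OF sigma_finite_lborel]) auto
  also have "\<dots> \<longleftrightarrow> (AE \<sigma> in lborel. enn2real (?k \<sigma>) = h \<sigma>)"
  proof
    assume "AE \<sigma> in lborel. ?k \<sigma> = ennreal (h \<sigma>)"
    then show "AE \<sigma> in lborel. enn2real (?k \<sigma>) = h \<sigma>"
      by eventually_elim (simp add: h0)
  next
    assume "AE \<sigma> in lborel. enn2real (?k \<sigma>) = h \<sigma>"
    then show "AE \<sigma> in lborel. ?k \<sigma> = ennreal (h \<sigma>)"
      using fin by eventually_elim (metis ennreal_enn2real infinity_ennreal_def less_top)
  qed
  also have "\<dots> \<longleftrightarrow> g \<in> marg_class D D0 s h"
    by (simp add: marg_class_def g LINT_range_Y1)
  finally show ?thesis .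
qed

text \<open>Scaling both measures by the positive finite slice mass reduces their equality to that
  of two Lebesgue densities. What remains is to extend agreement from the range of \<open>Y1\<close>
  on the slice to the whole line.\<close>

lemma conditional_density_eq_iff:
  fixes h :: "real \<Rightarrow> real"
  assumes g: "g \<in> densities D" and k: "0 < stat_density g \<sigma>" "stat_density g \<sigma> < \<infinity>"
    and cond: "density lborel (\<lambda>y. ennreal (transformed D0 s g \<sigma> y)) = density M (\<lambda>_. stat_density g \<sigma>)"
    and M: "sets M = sets borel"
    and [measurable]: "h \<in> borel_measurable borel" and h0: "\<And>y. 0 \<le> h y"
    and h1: "(\<integral>\<^sup>+ y. ennreal (h y) \<partial>lborel) = 1"
  shows "M = density lborel (\<lambda>y. ennreal (h y)) \<longleftrightarrow>
    (AE y in lborel. y \<in> range_Y1_given D s \<sigma> \<longrightarrow> transformed D0 s g \<sigma> y /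
         (LINT u:range_Y1_given D s \<sigma>|lborel. transformed D0 s g \<sigma> u) = h y)"
proof -
  let ?t = "\<lambda>y. transformed D0 s g \<sigma> y"
  define r where "r = enn2real (stat_density g \<sigma>)"
  have r: "0 < r" "stat_density g \<sigma> = ennreal r"
    using k by (simp_all add: r_def enn2real_positive_iff)
  have t0: "0 \<le> ?t y" for y
    using transformed_nonneg[OF densitiesD(2)[OF g]] .
  have [measurable]: "?t \<in> borel_measurable borel"
    by (rule borel_measurable_transformed_slice(1)[OF g])
  have LINT: "(LINT u:range_Y1_given D s \<sigma>|lborel. ?t u) = r"
    by (simp add: LINT_transformed[OF g in_range_Y1_given] r_def)
  have "M = density lborel (\<lambda>y. ennreal (h y)) \<longleftrightarrow>
      density M (\<lambda>_. stat_density g \<sigma>) = density (density lborel (\<lambda>y. ennreal (h y))) (\<lambda>_. stat_density g \<sigma>)"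
    using density_const_cancel[OF k, of M "density lborel (\<lambda>y. ennreal (h y))"] M by simp
  also have "\<dots> \<longleftrightarrow> density lborel (\<lambda>y. ennreal (?t y)) = density lborel (\<lambda>y. ennreal (h y) * stat_density g \<sigma>)"
    unfolding cond[symmetric] by (subst density_density_eq) auto
  also have "\<dots> \<longleftrightarrow> (AE y in lborel. ennreal (?t y) = ennreal (h y) * stat_density g \<sigma>)"
    by (rule sigma_finite_measure.density_unique_iff[OF sigma_finite_lborel]) auto
  also have "\<dots> \<longleftrightarrow> (AE y in lborel. ?t y / r = h y)"
    using r h0 t0 by (simp add: ennreal_mult[symmetric] field_simps)
  also have "\<dots> \<longleftrightarrow> (AE y in lborel. y \<in> range_Y1_given D s \<sigma> \<longrightarrow> ?t y / r = h y)"
  proof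
    assume on_range: "AE y in lborel. y \<in> range_Y1_given D s \<sigma> \<longrightarrow> ?t y / r = h y"
    have h_int: "integrable lborel h" "integral\<^sup>L lborel h = 1"
      using h0 h1 by (auto simp: integrable_iff_bounded integral_eq_nn_integral)
    have t_int: "integrable lborel ?t" "integral\<^sup>L lborel ?t = r"
      using t0 k by (auto simp: integrable_iff_bounded integral_eq_nn_integral r_def)
    \<comment> \<open>Off the range the left-hand side vanishes, hence it is dominated by \<open>h\<close>; both have mass 1.\<close>
    show "AE y in lborel. ?t y / r = h y"
    proof (rule sigma_finite_measure.integral_eq_mono_AE_eq_AE[OF sigma_finite_lborel])
      show "AE y in lborel. ?t y / r \<le> h y"
        using on_range
      proof eventually_elim
        case (elim y)
        then show ?case
          using h0 in_range_Y1_given[of \<sigma> y] by (cases "(\<sigma>, y) \<in> V") (auto simp: transformed_eq_0)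
      qed
    qed (use h_int t_int r in auto)
  qed auto
  finally show ?thesis
    by (simp add: LINT)
qed

section \<open>True conditional law \<kappa> against postulated conditional law \<open>K\<close>,
  slice by slice\<close>

context
  fixes P :: "'w measure" and X Y :: "'w \<Rightarrow> real" and g :: "real \<Rightarrow> real \<Rightarrow> real"
    and \<kappa> K :: "real \<Rightarrow> real measure" and h :: "real \<Rightarrow> real \<Rightarrow> real"
  assumes P: "prob_space P" and g: "g \<in> densities D"
    and joint: "distr P borel (\<lambda>\<omega>. (X \<omega>, Y \<omega>)) = distr (law g) borel (\<lambda>p. (stat s p, snd p))"
    and cond: "cond_law P X Y \<kappa>"
    and K: "\<And>\<sigma>. real_distribution (K \<sigma>)"
    and h: "\<And>\<sigma>. \<sigma> \<in> stat s ` D \<Longrightarrow> pdf_of (cdf (K \<sigma>)) (h \<sigma>)"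
begin

private abbreviation "k \<equiv> stat_density g"

text \<open>A slice of positive mass must meet \<open>V\<close>, so \<sigma> is a value of the
  statistic on \<open>D\<close>; only at such values is \<open>h\<close> known to be a density of
  \<open>K\<close>.\<close>

private lemma AE_regular_slice:
  "AE \<sigma> in distr P borel X. \<sigma> \<in> stat s ` D \<and> 0 < k \<sigma> \<and> k \<sigma> < \<infinity> \<and>
    density lborel (\<lambda>y. ennreal (transformed D0 s g \<sigma> y)) = density (\<kappa> \<sigma>) (\<lambda>_. k \<sigma>)"
  using cond_law_eq_density[OF P cond borel_measurable_ennreal_transformed[OF g] joint[unfolded distr_law[OF g]]]
proof eventually_elim
  case (elim \<sigma>)
  have "\<sigma> \<in> stat s ` D"
  proof (rule ccontr)
    assume "\<sigma> \<notin> stat s ` D"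
    then have "(\<sigma>, y) \<notin> V" for y
      using D0_subset by (force simp: stat_def change_vars_def)
    then show False
      using elim by (simp add: transformed_eq_0)
  qed
  then show ?case
    using elim by simp
qed

private lemmas kernel = cond_law_real_distribution[OF cond]

text \<open>On a regular slice, uniformity and class membership are both equivalent to
  \<open>\<kappa> \<sigma> = K \<sigma>\<close>.\<close>

lemma AE_uniform01_iff_cond_class_at:
  "AE \<sigma> in distr P borel X. uniform01 (\<kappa> \<sigma>) (cdf (K \<sigma>)) \<longleftrightarrow> g \<in> cond_class_at D D0 s h \<sigma>"
  using AE_regular_slice
proof eventually_elim
  case (elim \<sigma>)
  then have pdf: "pdf_of (cdf (K \<sigma>)) (h \<sigma>)"
    using h by simp
  note Kh = pdf_of_cdf[OF K pdf]
  interpret K: real_distribution "K \<sigma>" by (rule K)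
  have h\<sigma>: "h \<sigma> \<in> borel_measurable borel" "\<And>y. 0 \<le> h \<sigma> y"
    using pdf by (auto simp: pdf_of_def)
  have h1: "(\<integral>\<^sup>+ y. ennreal (h \<sigma> y) \<partial>lborel) = 1"
    using K.emeasure_space_1 h\<sigma> by (subst (asm) Kh(1)) (simp add: emeasure_density)
  have "uniform01 (\<kappa> \<sigma>) (cdf (K \<sigma>)) \<longleftrightarrow> \<kappa> \<sigma> = density lborel (\<lambda>y. ennreal (h \<sigma> y))"
    using uniform01_cdf_iff[OF kernel K Kh(2)] Kh(1) by simp
  also have "\<dots> \<longleftrightarrow> g \<in> cond_class_at D D0 s h \<sigma>"
    using elim kernel[of \<sigma>] g
    by (subst conditional_density_eq_iff[OF g _ _ _ _ h\<sigma> h1])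
      (auto simp: cond_class_at_def real_distribution_def real_distribution_axioms_def)
  finally show ?case .
qed

text \<open>Scaled by the same marginal density, both kernels equal the same slice of the joint
  density, so they coincide almost everywhere. This serves the case in which the model
  holds.\<close>

lemma AE_uniform01_of_cond_law:
  assumes "cond_law (law g) (stat s) snd K"
  shows "AE \<sigma> in distr P borel X. uniform01 (\<kappa> \<sigma>) (cdf (K \<sigma>))"
proof -
  have X: "distr P borel X = distr (law g) borel (stat s)"
    using distr_fst_density[OF _ _ borel_measurable_ennreal_transformed[OF g] joint[unfolded distr_law[OF g]]] cond
    by (simp add: distr_stat[OF g] cond_law_def)
  have "AE \<sigma> in distr P borel X. density lborel (\<lambda>y. ennreal (transformed D0 s g \<sigma> y)) = density (K \<sigma>) (\<lambda>_. k \<sigma>)"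
    using cond_law_eq_density[OF densitiesD(4)[OF g] assms borel_measurable_ennreal_transformed[OF g] distr_law[OF g]]
    unfolding X by eventually_elim simp
  then show ?thesis
    using AE_regular_slice
  proof eventually_elim
    case (elim \<sigma>)
    have "sets (\<kappa> \<sigma>) = sets (K \<sigma>)"
      using kernel[of \<sigma>] K[of \<sigma>] by (simp add: real_distribution_def real_distribution_axioms_def)
    then have "\<kappa> \<sigma> = K \<sigma>"
      using density_const_cancel[of "k \<sigma>" "\<kappa> \<sigma>" "K \<sigma>"] elim by simp
    then show ?case
      using uniform01_cdf_iff[OF kernel K] pdf_of_cdf(2)[OF K h] elim by metis
  qed
qed

end

end

lemma law_model:
  assumes "is_model D \<Gamma> \<Psi> f" "\<gamma> \<in> \<Gamma>" "\<psi> \<in> \<Psi>" "g \<in> densities D"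
    and "AE (y0, y1) in lborel. g y0 y1 = f \<gamma> \<psi> y1 y0"
  shows "law g = model_law f \<gamma> \<psi>"
proof -
  have f: "(\<lambda>y0 y1. f \<gamma> \<psi> y1 y0) \<in> densities D"
    using assms by (simp add: is_model_def)
  show ?thesis
    unfolding model_law_def law_def
    using assms(5) measurable_compose[OF densitiesD(1)[OF f] measurable_ennreal]
      measurable_compose[OF densitiesD(1)[OF assms(4)] measurable_ennreal]
    by (intro density_cong) (auto simp: split_beta')
qed

section \<open>Matched pairs\<close>

locale matched_pair =
  fixes P :: "'w measure" and Y1 Y0 :: "'w \<Rightarrow> real"
    and g :: "real \<Rightarrow> real \<Rightarrow> real"
    and D :: "(real \<times> real) set"
    and \<Gamma> :: "'c set" and \<Psi> :: "'p set"
    and f :: "'c \<Rightarrow> 'p \<Rightarrow> real \<Rightarrow> real \<Rightarrow> real"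
    and \<psi>0 :: 'p
  assumes P: "prob_space P"
    and g: "g \<in> densities D"
    and dist: "distributed P lborel (\<lambda>\<omega>. (Y0 \<omega>, Y1 \<omega>)) (\<lambda>(y0, y1). ennreal (g y0 y1))"
    and model: "is_model D \<Gamma> \<Psi> f"
    and \<psi>0: "\<psi>0 \<in> \<Psi>"
begin

lemma measurable_pair [measurable]: "(\<lambda>\<omega>. (Y0 \<omega>, Y1 \<omega>)) \<in> borel_measurable P"
  using dist by (auto simp: distributed_def)

lemma distr_compose:
  assumes "T \<in> borel_measurable borel"
  shows "distr P borel (\<lambda>\<omega>. T (Y0 \<omega>, Y1 \<omega>)) = distr (law g) borel T"
proof -
  have "law g = distr P lborel (\<lambda>\<omega>. (Y0 \<omega>, Y1 \<omega>))"
    using dist by (simp add: distributed_def law_def)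
  then show ?thesis
    using assms by (simp add: distr_distr comp_def)
qed

lemma joint_distr:
  assumes "stat s \<in> borel_measurable borel"
  shows "distr P borel (\<lambda>\<omega>. (s (Y1 \<omega>) (Y0 \<omega>), Y1 \<omega>)) = distr (law g) borel (\<lambda>p. (stat s p, snd p))"
proof -
  have "snd \<in> borel_measurable (borel :: (real \<times> real) measure)"
    by (intro borel_measurable_continuous_onI continuous_intros)
  then have "(\<lambda>p. (stat s p, snd p)) \<in> borel_measurable borel"
    using assms by measurable
  from distr_compose[OF this] show ?thesis
    by (simp add: stat_def)
qed

text \<open>Slice by slice, uniformity is equivalent to class membership almost everywhere. When the
  model holds, uniformity holds on almost every slice, so adding that disjunct preserves both
  equivalences.\<close>

lemma structure2_iff:
  assumes str: "structure2 D \<Gamma> \<Psi> f s F" and reg: "regular_change_vars D D0 (s \<psi>0)"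
    and pdf: "\<forall>\<sigma>\<in>stat (s \<psi>0) ` D. pdf_of (F \<psi>0 \<sigma>) (h \<sigma>)"
    and cond: "cond_law P (\<lambda>\<omega>. s \<psi>0 (Y1 \<omega>) (Y0 \<omega>)) Y1 \<kappa>"
  shows "(AE \<sigma> in distr P borel (\<lambda>\<omega>. s \<psi>0 (Y1 \<omega>) (Y0 \<omega>)).
           uniform01 (\<kappa> \<sigma>) (\<lambda>y1. F \<psi>0 \<sigma> y1) \<longleftrightarrow>
           model_holds_at \<Gamma> \<Psi> f g \<psi>0 \<or> g \<in> cond_class_at D D0 (s \<psi>0) h \<sigma>) \<and>
        ((AE \<sigma> in distr P borel (\<lambda>\<omega>. s \<psi>0 (Y1 \<omega>) (Y0 \<omega>)). uniform01 (\<kappa> \<sigma>) (\<lambda>y1. F \<psi>0 \<sigma> y1)) \<longleftrightarrow>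
           model_holds_at \<Gamma> \<Psi> f g \<psi>0 \<or> g \<in> cond_class D D0 (s \<psi>0) h)"
proof -
  let ?X = "\<lambda>\<omega>. s \<psi>0 (Y1 \<omega>) (Y0 \<omega>)"
  have model_kernel: "\<exists>K. cond_law (model_law f \<gamma> \<psi>0) (stat (s \<psi>0)) snd K \<and>
      (\<forall>\<sigma>. real_distribution (K \<sigma>) \<and> F \<psi>0 \<sigma> = cdf (K \<sigma>))" if \<gamma>: "\<gamma> \<in> \<Gamma>" for \<gamma>
  proof -
    from str have "\<forall>\<gamma>\<in>\<Gamma>. \<forall>\<psi>\<in>\<Psi>. cond_df (model_law f \<gamma> \<psi>) (stat (s \<psi>)) snd (F \<psi>)"
      unfolding structure2_def by (elim conjE)
    then have "cond_df (model_law f \<gamma> \<psi>0) (stat (s \<psi>0)) snd (F \<psi>0)"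
      using \<gamma> \<psi>0 by blast
    then obtain K where K: "cond_law (model_law f \<gamma> \<psi>0) (stat (s \<psi>0)) snd K" "\<forall>x y. F \<psi>0 x y = cdf (K x) y"
      unfolding cond_df_def by (elim exE conjE)
    then show ?thesis
      by (auto simp: fun_eq_iff intro: cond_law_real_distribution)
  qed
  obtain \<gamma>0 where "\<gamma>0 \<in> \<Gamma>"
    using model by (auto simp: is_model_def)
  from model_kernel[OF this] obtain K where K: "cond_law (model_law f \<gamma>0 \<psi>0) (stat (s \<psi>0)) snd K"
      "\<And>\<sigma>. real_distribution (K \<sigma>)" "\<And>\<sigma>. F \<psi>0 \<sigma> = cdf (K \<sigma>)"
    by auto
  \<comment> \<open>Measurability is contained in \<open>cond_law\<close> for a model law, whose
    sigma-algebra is the Borel one.\<close>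
  have meas: "stat (s \<psi>0) \<in> borel_measurable borel"
    using K(1) by (simp add: cond_law_def model_law_def law_def)
  interpret fibred_change_vars D D0 "s \<psi>0"
    using reg meas by unfold_locales
  have pdf': "pdf_of (cdf (K \<sigma>)) (h \<sigma>)" if "\<sigma> \<in> stat (s \<psi>0) ` D" for \<sigma>
    using pdf that K(3) by metis
  note AE_class = AE_uniform01_iff_cond_class_at[OF P g joint_distr[OF meas] cond K(2) pdf']
  have AE_model: "AE \<sigma> in distr P borel ?X. uniform01 (\<kappa> \<sigma>) (cdf (K \<sigma>))"
    if holds: "model_holds_at \<Gamma> \<Psi> f g \<psi>0"
  proof -
    obtain \<gamma> where \<gamma>: "\<gamma> \<in> \<Gamma>" "law g = model_law f \<gamma> \<psi>0"
      using holds law_model[OF model _ \<psi>0 g] by (auto simp: model_holds_at_def)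
    from model_kernel[OF \<gamma>(1)] obtain L where L: "cond_law (law g) (stat (s \<psi>0)) snd L"
        "\<And>\<sigma>. real_distribution (L \<sigma>)" "\<And>\<sigma>. F \<psi>0 \<sigma> = cdf (L \<sigma>)"
      unfolding \<gamma>(2) by auto
    \<comment> \<open>The true nuisance value may differ from \<open>\<gamma>0\<close>, but every
      kernel has the distribution function \<open>F \<psi>0 \<sigma>\<close> at \<sigma>, and that
      determines it.\<close>
    then have "L = K"
      using K by (intro ext cdf_unique) auto
    then show ?thesis
      using AE_uniform01_of_cond_law[OF P g joint_distr[OF meas] cond K(2) pdf'] L(1) by simp
  qed
  have X: "distr P borel ?X = distr (law g) borel (stat (s \<psi>0))"
    using distr_compose[OF meas] by (simp add: stat_def)
  have 1: "AE \<sigma> in distr P borel ?X. uniform01 (\<kappa> \<sigma>) (cdf (K \<sigma>)) \<longleftrightarrow>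
      model_holds_at \<Gamma> \<Psi> f g \<psi>0 \<or> g \<in> cond_class_at D D0 (s \<psi>0) h \<sigma>"
  proof (cases "model_holds_at \<Gamma> \<Psi> f g \<psi>0")
    case True
    from AE_model[OF True] show ?thesis
      by eventually_elim (simp add: True)
  next
    case False
    then show ?thesis
      using AE_class by simp
  qed
  have "(AE \<sigma> in distr P borel ?X. uniform01 (\<kappa> \<sigma>) (cdf (K \<sigma>))) \<longleftrightarrow>
      (AE \<sigma> in distr P borel ?X. g \<in> cond_class_at D D0 (s \<psi>0) h \<sigma>)"
    using AE_class by (rule eventually_subst)
  also have "\<dots> \<longleftrightarrow> g \<in> cond_class D D0 (s \<psi>0) h"
    unfolding X by (simp add: cond_class_def g)
  finally have "(AE \<sigma> in distr P borel ?X. uniform01 (\<kappa> \<sigma>) (cdf (K \<sigma>))) \<longleftrightarrow>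
      model_holds_at \<Gamma> \<Psi> f g \<psi>0 \<or> g \<in> cond_class D D0 (s \<psi>0) h"
    using AE_model by blast
  with 1 show ?thesis
    by (simp add: K(3))
qed

text \<open>Uniformity and class membership both say that the transformed variable has the
  postulated law. That law is the same for every nuisance value, so the model disjunct implies it as
  well.\<close>

lemma structure4_iff:
  assumes str: "structure4 D \<Gamma> \<Psi> f t F" and reg: "regular_change_vars D D0 (t \<psi>0)"
    and pdf: "pdf_of (F \<psi>0) h"
  shows "uniform01 P (\<lambda>\<omega>. F \<psi>0 (t \<psi>0 (Y1 \<omega>) (Y0 \<omega>))) \<longleftrightarrow>
           model_holds_at \<Gamma> \<Psi> f g \<psi>0 \<or> g \<in> marg_class D D0 (t \<psi>0) h"
proof -
  interpret fibred_change_vars D D0 "t \<psi>0"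
    using reg str \<psi>0 by unfold_locales (auto simp: structure4_def)
  let ?N = "\<lambda>\<gamma>. distr (model_law f \<gamma> \<psi>0) borel (stat (t \<psi>0))"
  let ?Z = "\<lambda>\<omega>. t \<psi>0 (Y1 \<omega>) (Y0 \<omega>)"
  have F: "F \<psi>0 = cdf (?N \<gamma>)" if "\<gamma> \<in> \<Gamma>" for \<gamma>
    using str that \<psi>0 by (auto simp: structure4_def fun_eq_iff)
  have N: "real_distribution (?N \<gamma>)" if "\<gamma> \<in> \<Gamma>" for \<gamma>
    using model that \<psi>0 unfolding model_law_def is_model_def by (intro real_distribution_stat) auto
  obtain \<gamma>0 where \<gamma>0: "\<gamma>0 \<in> \<Gamma>"
    using model by (auto simp: is_model_def)
  note pdf' = pdf[unfolded F[OF \<gamma>0]]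
  interpret N: real_distribution "?N \<gamma>0" by (rule N[OF \<gamma>0])
  have Z: "distr P borel ?Z = distr (law g) borel (stat (t \<psi>0))"
    using distr_compose[OF measurable_stat] by (simp add: stat_def)
  have [measurable]: "?Z \<in> borel_measurable P"
    using measurable_compose[OF measurable_pair measurable_stat] by (simp add: stat_def)
  have "uniform01 P (\<lambda>\<omega>. F \<psi>0 (?Z \<omega>)) \<longleftrightarrow> uniform01 (distr P borel ?Z) (F \<psi>0)"
    unfolding uniform01_def F[OF \<gamma>0] by (simp add: distr_distr comp_def)
  also have "\<dots> \<longleftrightarrow> distr (law g) borel (stat (t \<psi>0)) = ?N \<gamma>0"
    unfolding F[OF \<gamma>0] Z
    by (rule uniform01_cdf_iff[OF real_distribution_stat[OF g] N[OF \<gamma>0] pdf_of_cdf(2)[OF N[OF \<gamma>0] pdf']])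
  finally have unif: "uniform01 P (\<lambda>\<omega>. F \<psi>0 (?Z \<omega>)) \<longleftrightarrow> distr (law g) borel (stat (t \<psi>0)) = ?N \<gamma>0" .
  have "distr (law g) borel (stat (t \<psi>0)) = ?N \<gamma>0" if holds: "model_holds_at \<Gamma> \<Psi> f g \<psi>0"
  proof -
    obtain \<gamma> where \<gamma>: "\<gamma> \<in> \<Gamma>" "law g = model_law f \<gamma> \<psi>0"
      using holds law_model[OF model _ \<psi>0 g] by (auto simp: model_holds_at_def)
    \<comment> \<open>The laws at \<gamma> and at \<open>\<gamma>0\<close> share the distribution
      function \<open>F \<psi>0\<close> and hence coincide.\<close>
    then show ?thesis
      using cdf_unique[OF N N] F \<gamma>0 by metis
  qed
  then show ?thesis
    using unif distr_stat_eq_iff_marg_class[OF g N[OF \<gamma>0] pdf'] by blast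
qed

end

theorem proposition4p1:
  fixes P :: "'w measure" and Y1 Y0 :: "'w \<Rightarrow> real"
    and gstar :: "real \<Rightarrow> real \<Rightarrow> real"
    and D :: "(real \<times> real) set"
    and \<Gamma> :: "'c set" and \<Psi> :: "'p set"
    and f :: "'c \<Rightarrow> 'p \<Rightarrow> real \<Rightarrow> real \<Rightarrow> real"
    and \<psi>0 :: 'p
  assumes "prob_space P"
    and "gstar \<in> densities D"
    and "distributed P lborel (\<lambda>\<omega>. (Y0 \<omega>, Y1 \<omega>)) (\<lambda>(y0, y1). ennreal (gstar y0 y1))"
    and "is_model D \<Gamma> \<Psi> f"
    and "\<psi>0 \<in> \<Psi>"
  shows
    "(\<forall>s F h D0 \<kappa>.
        structure1 D \<Gamma> \<Psi> f s F \<and> regular_change_vars D D0 s \<and>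
        (\<forall>\<sigma>\<in>stat s ` D. pdf_of (F \<psi>0 \<sigma>) (h \<sigma>)) \<and>
        cond_law P (\<lambda>\<omega>. s (Y1 \<omega>) (Y0 \<omega>)) Y1 \<kappa> \<longrightarrow>
        (AE \<sigma> in distr P borel (\<lambda>\<omega>. s (Y1 \<omega>) (Y0 \<omega>)).
           uniform01 (\<kappa> \<sigma>) (\<lambda>y1. F \<psi>0 \<sigma> y1) \<longleftrightarrow>
           model_holds_at \<Gamma> \<Psi> f gstar \<psi>0 \<or> gstar \<in> cond_class_at D D0 s h \<sigma>) \<and>
        ((AE \<sigma> in distr P borel (\<lambda>\<omega>. s (Y1 \<omega>) (Y0 \<omega>)). uniform01 (\<kappa> \<sigma>) (\<lambda>y1. F \<psi>0 \<sigma> y1)) \<longleftrightarrow>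
           model_holds_at \<Gamma> \<Psi> f gstar \<psi>0 \<or> gstar \<in> cond_class D D0 s h)) \<and>
     (\<forall>s F h D0 \<kappa>.
        structure2 D \<Gamma> \<Psi> f s F \<and> regular_change_vars D D0 (s \<psi>0) \<and>
        (\<forall>\<sigma>\<in>stat (s \<psi>0) ` D. pdf_of (F \<psi>0 \<sigma>) (h \<sigma>)) \<and>
        cond_law P (\<lambda>\<omega>. s \<psi>0 (Y1 \<omega>) (Y0 \<omega>)) Y1 \<kappa> \<longrightarrow>
        (AE \<sigma> in distr P borel (\<lambda>\<omega>. s \<psi>0 (Y1 \<omega>) (Y0 \<omega>)).
           uniform01 (\<kappa> \<sigma>) (\<lambda>y1. F \<psi>0 \<sigma> y1) \<longleftrightarrow>
           model_holds_at \<Gamma> \<Psi> f gstar \<psi>0 \<or> gstar \<in> cond_class_at D D0 (s \<psi>0) h \<sigma>) \<and>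
        ((AE \<sigma> in distr P borel (\<lambda>\<omega>. s \<psi>0 (Y1 \<omega>) (Y0 \<omega>)). uniform01 (\<kappa> \<sigma>) (\<lambda>y1. F \<psi>0 \<sigma> y1)) \<longleftrightarrow>
           model_holds_at \<Gamma> \<Psi> f gstar \<psi>0 \<or> gstar \<in> cond_class D D0 (s \<psi>0) h)) \<and>
     (\<forall>t F h D0.
        structure3 D \<Gamma> \<Psi> f t F \<and> regular_change_vars D D0 t \<and> pdf_of (F \<psi>0) h \<longrightarrow>
        (uniform01 P (\<lambda>\<omega>. F \<psi>0 (t (Y1 \<omega>) (Y0 \<omega>))) \<longleftrightarrow>
           model_holds_at \<Gamma> \<Psi> f gstar \<psi>0 \<or> gstar \<in> marg_class D D0 t h)) \<and>
     (\<forall>t F h D0.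
        structure4 D \<Gamma> \<Psi> f t F \<and> regular_change_vars D D0 (t \<psi>0) \<and> pdf_of (F \<psi>0) h \<longrightarrow>
        (uniform01 P (\<lambda>\<omega>. F \<psi>0 (t \<psi>0 (Y1 \<omega>) (Y0 \<omega>))) \<longleftrightarrow>
           model_holds_at \<Gamma> \<Psi> f gstar \<psi>0 \<or> gstar \<in> marg_class D D0 (t \<psi>0) h))"
proof -
  interpret matched_pair P Y1 Y0 gstar D \<Gamma> \<Psi> f \<psi>0
    using assms by (rule matched_pair.intro)
  \<comment> \<open>Structures 1 and 3 are Structures 2 and 4 for a statistic or transformation
    constant in \<psi>.\<close>
  show ?thesis
    unfolding structure1_def structure3_def
    apply (rule conjI[OF _ conjI[OF _ conjI]]; intro allI impI; elim conjE)
    subgoal for s by (rule structure2_iff[where s = "\<lambda>\<psi>. s"])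
    subgoal for s by (rule structure2_iff[where s = s])
    subgoal for t by (rule structure4_iff[where t = "\<lambda>\<psi>. t"])
    subgoal for t by (rule structure4_iff[where t = t])
    done
qed

end
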